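(* Let $\alpha\in(0,1)$, $\kappa>0$, $\epsilon>0$, and let $0=t_0<t_1<\cdots<t_N=T$ be a time mesh with steps $\tau_n=t_n-t_{n-1}$ satisfying $$\tau_n\le \left(\frac{4\epsilon^2}{\kappa\,\Gamma(2-\alpha)}\right)^{1/\alpha}\qquad\text{for }1\le n\le N .$$ Then the variable-step L1 scheme preserves the following discrete energy dissipation law: every solution $\{\phi^n\}_{n=0}^N$ of the scheme $$\sum_{k=1}^n a_{n-k}^{(n)}(\phi^k-\phi^{k-1})=\kappa\Delta\mu^n,\qquad \mu^n=(\phi^n)^3-\phi^n-\epsilon^2\Delta\phi^n,\qquad 1\le n\le N,$$ satisfies $$\partial_\tau\mathcal{E}_\alpha[\phi^n]:=\frac{\mathcal{E}_\alpha[\phi^n]-\mathcal{E}_\alpha[\phi^{n-1}]}{\tau_n}\le 0\qquad\text{for }1\le n\le N .$$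
   Context: Setting: $\Omega\subset\mathbb{R}^2$ is a rectangle with periodic boundary conditions; $(\cdot,\cdot)$ and $\|\cdot\|$ are the $L^2(\Omega)$ inner product and norm. The initial function $\phi^0\in H^1(\Omega)$ is real-valued and periodic; $\phi^n,\mu^n$ are real-valued periodic $H^1(\Omega)$ functions and the equations of the scheme are understood in the usual weak sense (tested against periodic $H^1$ functions). Kernels: with $\omega_\beta(t):=t^{\beta-1}/\Gamma(\beta)$, the L1 kernels are $a_{n-k}^{(n)}:=\frac1{\tau_k}\int_{t_{k-1}}^{t_k}\omega_{1-\alpha}(t_n-s)\,\mathrm{d}s$ for $1\le k\le n$. The discrete orthogonal convolution kernels are $\theta_0^{(n)}:=1/a_0^{(n)}$ and $\theta_{n-k}^{(n)}:=-\frac1{a_0^{(k)}}\sum_{j=k+1}^n\theta_{n-j}^{(n)}a_{j-k}^{(j)}$ for $1\le k\le n-1$. The discrete complementary convolution kernels are $p_{n-k}^{(n)}:=\sum_{j=k}^n\theta_{j-k}^{(j)}$ for $1\le k\le n$. Energies: $E[\phi^n]:=\frac{\epsilon^2}{2}\|\nabla\phi^n\|^2+(F(\phi^n),1)$ with $F(\phi):=\frac14(\phi^2-1)^2$ for $n\ge0$; the discrete variational energy is $\mathcal{E}_\alpha[\phi^0]:=E[\phi^0]$ and $$\mathcal{E}_\alpha[\phi^n]:=E[\phi^n]+\frac{\kappa}{2}\sum_{j=1}^n p_{n-j}^{(n)}\|\nabla\mu^j\|^2\quad\text{for }n\ge1 .$$ *)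

theory Defs
  imports "HOL-Analysis.Analysis"
begin

section \<open>\<open>L\<^sup>2\<close> and periodic \<open>H\<^sup>1\<close> functions on a rectangle\<close>

definition square_integrable ::
  "(real \<times> real) set \<Rightarrow> (real \<times> real \<Rightarrow> 'b::euclidean_space) \<Rightarrow> bool" where
  "square_integrable \<Omega> f \<longleftrightarrow>
     set_borel_measurable lborel \<Omega> f \<and> set_integrable lborel \<Omega> (\<lambda>x. (norm (f x))\<^sup>2)"

definition l2_inner ::
  "(real \<times> real) set \<Rightarrow> (real \<times> real \<Rightarrow> 'b::euclidean_space) \<Rightarrow> (real \<times> real \<Rightarrow> 'b) \<Rightarrow> real" where
  "l2_inner \<Omega> f g = (LINT x:\<Omega>|lborel. f x \<bullet> g x)"

definition l2_norm :: "(real \<times> real) set \<Rightarrow> (real \<times> real \<Rightarrow> 'b::euclidean_space) \<Rightarrow> real" where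
  "l2_norm \<Omega> f = sqrt (l2_inner \<Omega> f f)"

primrec C_k :: "nat \<Rightarrow> (real \<times> real \<Rightarrow> real) \<Rightarrow> bool" where
  "C_k 0 f \<longleftrightarrow> continuous_on UNIV f"
| "C_k (Suc k) f \<longleftrightarrow>
     (\<exists>g. (\<forall>x. GDERIV f x :> g x) \<and> C_k k (\<lambda>x. fst (g x)) \<and> C_k k (\<lambda>x. snd (g x)))"

text \<open>The rectangle is \<^term>\<open>box p q\<close>, with lower left corner \<open>p\<close> and upper right corner \<open>q\<close>.\<close>

definition periodic :: "real \<times> real \<Rightarrow> real \<times> real \<Rightarrow> (real \<times> real \<Rightarrow> real) \<Rightarrow> bool" where
  "periodic p q f \<longleftrightarrow>
     (\<forall>x y. f (x + (fst q - fst p), y) = f (x, y) \<and> f (x, y + (snd q - snd p)) = f (x, y))"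

definition smooth_periodic :: "real \<times> real \<Rightarrow> real \<times> real \<Rightarrow> (real \<times> real \<Rightarrow> real) \<Rightarrow> bool" where
  "smooth_periodic p q f \<longleftrightarrow> periodic p q f \<and> (\<forall>k. C_k k f)"

text \<open>
  The periodic Sobolev space \<open>H\<^sup>1\<close>: square integrable functions on the rectangle with a square
  integrable distributional gradient on the torus. The test functions are periodic and smooth on
  the whole plane and need not vanish on the boundary of the rectangle, so the integration by parts
  formula has no boundary term exactly when the traces on opposite sides agree; this is how the
  periodic boundary condition is encoded. Values outside the rectangle are irrelevant.
\<close>

definition has_weak_gradient ::
  "real \<times> real \<Rightarrow> real \<times> real \<Rightarrow> (real \<times> real \<Rightarrow> real) \<Rightarrow> (real \<times> real \<Rightarrow> real \<times> real) \<Rightarrow> bool" where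
  "has_weak_gradient p q u G \<longleftrightarrow>
     square_integrable (box p q) u \<and> square_integrable (box p q) G \<and>
     (\<forall>\<psi> D. smooth_periodic p q \<psi> \<longrightarrow> (\<forall>x. GDERIV \<psi> x :> D x) \<longrightarrow>
        (LINT x:box p q|lborel. u x *\<^sub>R D x) = - (LINT x:box p q|lborel. \<psi> x *\<^sub>R G x))"

definition H1_periodic :: "real \<times> real \<Rightarrow> real \<times> real \<Rightarrow> (real \<times> real \<Rightarrow> real) set" where
  "H1_periodic p q = {u. \<exists>G. has_weak_gradient p q u G}"

text \<open>The weak gradient is determined up to a null set, so the choice below is immaterial.\<close>

definition weak_gradient ::
  "real \<times> real \<Rightarrow> real \<times> real \<Rightarrow> (real \<times> real \<Rightarrow> real) \<Rightarrow> real \<times> real \<Rightarrow> real \<times> real" where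
  "weak_gradient p q u = (SOME G. has_weak_gradient p q u G)"


section \<open>Discrete convolution kernels\<close>

text \<open>
  The time mesh is \<^term>\<open>t :: nat \<Rightarrow> real\<close>. A kernel with superscript \<open>(n)\<close> and
  subscript \<open>m\<close> is applied to the arguments \<open>n\<close> and \<open>m\<close> in this order.
\<close>

definition time_step :: "(nat \<Rightarrow> real) \<Rightarrow> nat \<Rightarrow> real" where
  "time_step t n = t n - t (n - 1)"

definition omega :: "real \<Rightarrow> real \<Rightarrow> real" where
  "omega \<beta> s = s powr (\<beta> - 1) / Gamma \<beta>"

definition L1_kernel :: "real \<Rightarrow> (nat \<Rightarrow> real) \<Rightarrow> nat \<Rightarrow> nat \<Rightarrow> real" where
  "L1_kernel \<alpha> t n m =
     (let k = n - m in 1 / time_step t k * integral {t (k - 1)..t k} (\<lambda>s. omega (1 - \<alpha>) (t n - s)))"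

function DOC_kernel :: "real \<Rightarrow> (nat \<Rightarrow> real) \<Rightarrow> nat \<Rightarrow> nat \<Rightarrow> real" where
  "DOC_kernel \<alpha> t n m =
     (if m = 0 then 1 / L1_kernel \<alpha> t n 0
      else let k = n - m in
        - (1 / L1_kernel \<alpha> t k 0) *
          (\<Sum>j=k+1..n. DOC_kernel \<alpha> t n (n - j) * L1_kernel \<alpha> t j (j - k)))"
  by pat_completeness auto
termination by (relation "Wellfounded.measure (\<lambda>(\<alpha>, t, n, m). m)") auto

declare DOC_kernel.simps [simp del]

definition DCC_kernel :: "real \<Rightarrow> (nat \<Rightarrow> real) \<Rightarrow> nat \<Rightarrow> nat \<Rightarrow> real" where
  "DCC_kernel \<alpha> t n m = (let k = n - m in \<Sum>j=k..n. DOC_kernel \<alpha> t j (j - k))"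


section \<open>Energies and the variable-step L1 scheme\<close>

definition double_well :: "real \<Rightarrow> real" where
  "double_well z = 1 / 4 * (z\<^sup>2 - 1)\<^sup>2"

definition energy :: "real \<times> real \<Rightarrow> real \<times> real \<Rightarrow> real \<Rightarrow> (real \<times> real \<Rightarrow> real) \<Rightarrow> real" where
  "energy p q \<epsilon> u =
     \<epsilon>\<^sup>2 / 2 * (l2_norm (box p q) (weak_gradient p q u))\<^sup>2 + l2_inner (box p q) (\<lambda>x. double_well (u x)) (\<lambda>x. 1)"

text \<open>For \<open>n = 0\<close> the sum is empty and only the energy of the initial function remains.\<close>

definition variational_energy ::
  "real \<times> real \<Rightarrow> real \<times> real \<Rightarrow> real \<Rightarrow> real \<Rightarrow> real \<Rightarrow> (nat \<Rightarrow> real) \<Rightarrow>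
   (nat \<Rightarrow> real \<times> real \<Rightarrow> real) \<Rightarrow> (nat \<Rightarrow> real \<times> real \<Rightarrow> real) \<Rightarrow> nat \<Rightarrow> real" where
  "variational_energy p q \<alpha> \<kappa> \<epsilon> t \<phi> \<mu> n =
     energy p q \<epsilon> (\<phi> n) +
     \<kappa> / 2 * (\<Sum>j=1..n. DCC_kernel \<alpha> t n (n - j) *
                          (l2_norm (box p q) (weak_gradient p q (\<mu> j)))\<^sup>2)"

definition L1_scheme_solution ::
  "real \<times> real \<Rightarrow> real \<times> real \<Rightarrow> real \<Rightarrow> real \<Rightarrow> real \<Rightarrow> nat \<Rightarrow> (nat \<Rightarrow> real) \<Rightarrow>
   (nat \<Rightarrow> real \<times> real \<Rightarrow> real) \<Rightarrow> (nat \<Rightarrow> real \<times> real \<Rightarrow> real) \<Rightarrow> bool" where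
  "L1_scheme_solution p q \<alpha> \<kappa> \<epsilon> N t \<phi> \<mu> \<longleftrightarrow>
     (\<forall>n\<in>{0..N}. \<phi> n \<in> H1_periodic p q) \<and>
     (\<forall>n\<in>{1..N}. \<mu> n \<in> H1_periodic p q) \<and>
     (\<forall>n\<in>{1..N}. \<forall>v\<in>H1_periodic p q.
        l2_inner (box p q) (\<lambda>x. \<Sum>k=1..n. L1_kernel \<alpha> t n (n - k) * (\<phi> k x - \<phi> (k - 1) x)) v =
          - \<kappa> * l2_inner (box p q) (weak_gradient p q (\<mu> n)) (weak_gradient p q v) \<and>
        l2_inner (box p q) (\<mu> n) v =
          l2_inner (box p q) (\<lambda>x. (\<phi> n x) ^ 3 - \<phi> n x) v +
          \<epsilon>\<^sup>2 * l2_inner (box p q) (weak_gradient p q (\<phi> n)) (weak_gradient p q v))"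

end

theory Submission
  imports Defs
begin

text \<open>
  Write \<open>m\<^sub>j = \<nabla>\<mu>\<^sup>j\<close>, \<open>\<delta> = \<phi>\<^sup>n - \<phi>\<^sup>n\<^sup>-\<^sup>1\<close>, \<open>d = \<nabla>\<phi>\<^sup>n - \<nabla>\<phi>\<^sup>n\<^sup>-\<^sup>1\<close> and \<open>\<theta>\<^sub>j\<close> for the orthogonal kernel
  with superscript \<open>n\<close> and subscript \<open>n - j\<close>. The orthogonal kernels are the rows of the inverse of the
  lower triangular matrix of L1 kernels, so the scheme yields \<open>\<delta> = \<kappa> div w\<close> in the weak
  sense, with \<open>w = \<Sum>\<^sub>j\<^sub>\<le>\<^sub>n \<theta>\<^sub>j m\<^sub>j\<close> (\<open>orthogonal_kernel_inverts\<close>). Testing with \<open>\<mu>\<^sup>n\<close>, \<open>\<phi>\<^sup>n\<close> and \<open>\<phi>\<^sup>n\<^sup>-\<^sup>1\<close>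
  gives \<open>(\<delta>, \<mu>\<^sup>n) = - \<kappa> (w, m\<^sub>n)\<close> and \<open>\<parallel>\<delta>\<parallel>\<^sup>2 = - \<kappa> (w, d)\<close>. Since the double well satisfies
  \<open>F(a) - F(b) \<le> F'(a) (a - b) + (a - b)\<^sup>2 / 2\<close>, the free energy increases by at most
  \<open>(\<mu>\<^sup>n, \<delta>) + \<parallel>\<delta>\<parallel>\<^sup>2 / 2 - \<epsilon>\<^sup>2 \<parallel>d\<parallel>\<^sup>2 / 2\<close> (\<open>energy_diff_le\<close>), while the memory term of the variational energy
  increases by exactly \<open>\<kappa> / 2 \<cdot> \<Sum>\<^sub>j \<theta>\<^sub>j \<parallel>m\<^sub>j\<parallel>\<^sup>2\<close> (\<open>DCC_kernel_sum_diff\<close>). It remains to see that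
  \<open>\<kappa> / 2 \<cdot> \<Sum>\<^sub>j \<theta>\<^sub>j \<bar>m\<^sub>j\<bar>\<^sup>2 - \<kappa> w \<bullet> m\<^sub>n - \<kappa> / 2 \<cdot> w \<bullet> d - \<epsilon>\<^sup>2 / 2 \<cdot> \<bar>d\<bar>\<^sup>2 \<le> 0\<close>, and this holds pointwise
  (\<open>energy_increment_density_nonpos\<close>).

  The pointwise inequality uses three properties of the kernels: \<open>\<theta>\<^sub>j \<le> 0\<close> for \<open>j < n\<close>,
  \<open>\<Sum>\<^sub>j \<theta>\<^sub>j \<ge> 0\<close>, and \<open>\<kappa> \<theta>\<^sub>n \<le> 4 \<epsilon>\<^sup>2\<close>. The third is the restriction on the time steps
  (\<open>DOC_kernel_step_bound\<close>). The first two come from the L1 kernel matrix: its columns decrease, and the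
  ratio of two neighbouring columns increases down the rows, because \<open>\<omega>\<^sub>1\<^sub>-\<^sub>\<alpha>\<close> is decreasing and
  logarithmically convex (\<open>L1_kernel_antimono\<close>, \<open>L1_kernel_cross\<close>).

  The formal computation needs the integrals of \<open>F(\<phi>\<^sup>n)\<close> and of \<open>((\<phi>\<^sup>n)\<^sup>3 - \<phi>\<^sup>n) v\<close> to be finite, that is,
  the two-dimensional Sobolev embedding of periodic \<open>H\<^sup>1\<close> into \<open>L\<^sup>4\<close> (\<open>H1_periodic_L4\<close>). It is proved
  directly from the weak definition, following Ladyzhenskaya: \<open>\<bar>u(x, y)\<bar>\<close> is bounded by a square
  integrable function \<open>f(y)\<close> and also by a square integrable function \<open>g(x)\<close>, so that
  \<open>u\<^sup>4 \<le> f(y)\<^sup>2 g(x)\<^sup>2\<close>. The envelope \<open>f(y)\<close> is the mean of \<open>\<bar>u(\<cdot>, y)\<bar>\<close> plus the integral of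
  \<open>\<bar>\<partial>\<^sub>x u(\<cdot>, y)\<bar>\<close>; that it dominates \<open>u\<close> follows by testing the weak derivative with products \<open>a(x) b(y)\<close>
  of smooth periodic functions, where \<open>a'\<close> and \<open>b\<close> approximate indicators of intervals, the former up to
  an additive constant (\<open>weak_derivative_slice_bound\<close>).

  The vector \<open>d\<close> is the difference of the chosen weak gradients of \<open>\<phi>\<^sup>n\<close> and \<open>\<phi>\<^sup>n\<^sup>-\<^sup>1\<close>, not the chosen weak
  gradient of \<open>\<delta>\<close>. As the scheme is linear in its test function, every identity for \<open>d\<close> is obtained by
  subtracting the one for the test function \<open>\<phi>\<^sup>n\<^sup>-\<^sup>1\<close> from the one for \<open>\<phi>\<^sup>n\<close>.
\<close>

section \<open>Smooth periodic functions of one variable and their products\<close>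

text \<open>
  The one-variable counterpart of \<open>C_k\<close>; products of such functions in separate variables
  serve as test functions on the plane.
\<close>

primrec diff_k :: "nat \<Rightarrow> (real \<Rightarrow> real) \<Rightarrow> bool" where
  "diff_k 0 f \<longleftrightarrow> continuous_on UNIV f"
| "diff_k (Suc k) f \<longleftrightarrow> (\<exists>f'. (\<forall>x. (f has_real_derivative f' x) (at x)) \<and> diff_k k f')"

definition smooth1 :: "(real \<Rightarrow> real) \<Rightarrow> bool" where
  "smooth1 f \<longleftrightarrow> (\<forall>k. diff_k k f)"

lemma diff_k_SucD: "diff_k (Suc k) f \<Longrightarrow> diff_k k f"
proof (induction k arbitrary: f)
  case 0
  then show ?case
    by (auto intro!: continuous_at_imp_continuous_on dest: DERIV_isCont)
next
  case (Suc k)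
  then show ?case by (metis diff_k.simps(2))
qed

lemma diff_k_const: "diff_k k (\<lambda>x. c)"
  by (induction k arbitrary: c) (auto intro!: derivative_intros exI[of _ "\<lambda>x. 0"])

lemma diff_k_add: "diff_k k f \<Longrightarrow> diff_k k g \<Longrightarrow> diff_k k (\<lambda>x. f x + g x)"
proof (induction k arbitrary: f g)
  case (Suc k)
  then obtain f' g' where "\<forall>x. (f has_real_derivative f' x) (at x)" "diff_k k f'"
    "\<forall>x. (g has_real_derivative g' x) (at x)" "diff_k k g'" by auto
  then show ?case using Suc.IH[of f' g'] by (auto intro!: derivative_intros exI[of _ "\<lambda>x. f' x + g' x"])
qed (auto intro!: continuous_intros)

lemma diff_k_mult: "diff_k k f \<Longrightarrow> diff_k k g \<Longrightarrow> diff_k k (\<lambda>x. f x * g x)"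
proof (induction k arbitrary: f g)
  case (Suc k)
  then obtain f' g' where fg: "\<forall>x. (f has_real_derivative f' x) (at x)" "diff_k k f'"
    "\<forall>x. (g has_real_derivative g' x) (at x)" "diff_k k g'" by auto
  have "diff_k k f" "diff_k k g" using Suc.prems diff_k_SucD by auto
  then have "diff_k k (\<lambda>x. f' x * g x + f x * g' x)"
    using fg by (intro diff_k_add Suc.IH) auto
  moreover have "\<forall>x. ((\<lambda>x. f x * g x) has_real_derivative f' x * g x + f x * g' x) (at x)"
    using fg by (auto intro!: derivative_eq_intros)
  ultimately show ?case by auto
qed (auto intro!: continuous_intros)

lemma smooth1_I:
  assumes "\<And>x. (f has_real_derivative f' x) (at x)" "smooth1 f'"
  shows "smooth1 f"
  unfolding smooth1_def
proof
  fix k show "diff_k k f"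
    using assms diff_k_SucD[of k f] by (auto simp: smooth1_def)
qed

text \<open>
  Each order of differentiability comes with its own derivative; uniqueness of derivatives identifies
  them with the given one.
\<close>

lemma smooth1_D:
  assumes "\<And>x. (f has_real_derivative f' x) (at x)" "smooth1 f"
  shows "smooth1 f'"
  unfolding smooth1_def
proof
  fix k
  from assms(2) have "diff_k (Suc k) f" by (simp add: smooth1_def)
  then obtain g where "\<forall>x. (f has_real_derivative g x) (at x)" "diff_k k g" by auto
  moreover from this assms(1) have "g = f'" by (auto intro: DERIV_unique)
  ultimately show "diff_k k f'" by simp
qed

lemma smooth1_continuous: "smooth1 f \<Longrightarrow> continuous_on A f"
  using continuous_on_subset unfolding smooth1_def by (metis diff_k.simps(1) subset_UNIV)

lemma smooth1_add: "smooth1 f \<Longrightarrow> smooth1 g \<Longrightarrow> smooth1 (\<lambda>x. f x + g x)"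
  and smooth1_mult: "smooth1 f \<Longrightarrow> smooth1 g \<Longrightarrow> smooth1 (\<lambda>x. f x * g x)"
  and smooth1_const: "smooth1 (\<lambda>x. c)"
  by (auto simp: smooth1_def diff_k_add diff_k_mult diff_k_const)

lemma smooth1_cos_affine: "smooth1 (\<lambda>x. cos (a * x + b))"
proof -
  have "diff_k k (\<lambda>x. cos (a * x + b)) \<and> diff_k k (\<lambda>x. sin (a * x + b))" for k
  proof (induction k)
    case 0
    show ?case by (auto intro!: continuous_intros)
  next
    case (Suc k)
    have "diff_k k (\<lambda>x. - a * sin (a * x + b))" "diff_k k (\<lambda>x. a * cos (a * x + b))"
      using Suc diff_k_mult[OF diff_k_const[of k "- a"]] diff_k_mult[OF diff_k_const[of k a]] by auto
    moreover have "\<forall>x. ((\<lambda>x. cos (a * x + b)) has_real_derivative (- a * sin (a * x + b))) (at x)"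
      "\<forall>x. ((\<lambda>x. sin (a * x + b)) has_real_derivative (a * cos (a * x + b))) (at x)"
      by (auto intro!: derivative_eq_intros)
    ultimately show ?case by auto
  qed
  then show ?thesis by (simp add: smooth1_def)
qed

text \<open>
  The logistic function is smooth, takes values in \<open>(0, 1)\<close>, and steepens to a step function. Its
  differential equation \<open>s' = s (1 - s)\<close> makes the smoothness of compositions a simple
  induction on the order.
\<close>

definition logistic :: "real \<Rightarrow> real" where
  "logistic x = 1 / (1 + exp (- x))"

lemma logistic_deriv: "(logistic has_real_derivative logistic x * (1 - logistic x)) (at x)"
proof -
  have "1 + exp (- x) > 0" by (simp add: add_pos_pos)
  then show ?thesis unfolding logistic_def[abs_def]
    by (auto intro!: derivative_eq_intros simp: field_simps power2_eq_square)
qed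

lemma logistic_bounds: "0 < logistic x" "logistic x < 1"
  by (auto simp: logistic_def add_pos_pos field_simps)

lemma smooth1_logistic_compose:
  assumes h: "smooth1 h"
  shows "smooth1 (\<lambda>x. logistic (h x))"
  unfolding smooth1_def
proof
  from h have "diff_k (Suc 0) h" by (simp only: smooth1_def)
  then obtain h' where h': "\<And>x. (h has_real_derivative h' x) (at x)" by auto
  then have sh': "smooth1 h'" using h smooth1_D by blast
  have der: "((\<lambda>x. logistic (h x)) has_real_derivative logistic (h x) * (1 + (-1) * logistic (h x)) * h' x) (at x)" for x
    using DERIV_chain2[OF logistic_deriv h'] by simp
  fix k
  show "diff_k k (\<lambda>x. logistic (h x))"
  proof (induction k)
    case 0
    show ?case using der by (auto intro!: continuous_at_imp_continuous_on dest: DERIV_isCont)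
  next
    case (Suc k)
    have "diff_k k (\<lambda>x. logistic (h x) * (1 + (-1) * logistic (h x)) * h' x)"
      using sh' by (intro diff_k_mult diff_k_add diff_k_const Suc) (simp add: smooth1_def)
    then show ?case using der by (simp, intro exI[of _ "\<lambda>x. logistic (h x) * (1 + (-1) * logistic (h x)) * h' x"]) auto
  qed
qed

lemma GDERIV_prod:
  assumes "(a has_real_derivative a') (at (fst z))" "(b has_real_derivative b') (at (snd z))"
  shows "GDERIV (\<lambda>z::real \<times> real. a (fst z) * b (snd z)) z :> (a' * b (snd z), a (fst z) * b')"
proof -
  have "((\<lambda>z. a (fst z)) has_derivative (\<lambda>h. a' * fst h)) (at z)"
    "((\<lambda>z. b (snd z)) has_derivative (\<lambda>h. b' * snd h)) (at z)"
    using has_derivative_compose[OF has_derivative_fst[OF has_derivative_ident], of a _ z]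
      has_derivative_compose[OF has_derivative_snd[OF has_derivative_ident], of b _ z] assms
    unfolding has_field_derivative_def by blast+
  from has_derivative_mult[OF this] show ?thesis
    by (simp add: gderiv_def inner_prod_def algebra_simps)
qed

lemma C_k_prod:
  "diff_k k a \<Longrightarrow> diff_k k b \<Longrightarrow> C_k k (\<lambda>z. a (fst z) * b (snd z))"
proof (induction k arbitrary: a b)
  case 0
  then show ?case by (auto intro!: continuous_intros continuous_on_compose2[of UNIV a] continuous_on_compose2[of UNIV b])
next
  case (Suc k)
  then obtain a' b' where ab: "\<And>x. (a has_real_derivative a' x) (at x)" "diff_k k a'"
    "\<And>x. (b has_real_derivative b' x) (at x)" "diff_k k b'" by auto
  have "diff_k k a" "diff_k k b" using Suc.prems diff_k_SucD by auto
  then show ?case using ab GDERIV_prod[OF ab(1,3)] Suc.IH[of a' b] Suc.IH[of a b']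
    by (auto intro!: exI[of _ "\<lambda>z. (a' (fst z) * b (snd z), a (fst z) * b' (snd z))"])
qed

lemma smooth_periodic_prod:
  assumes "smooth1 a" "\<And>x. a (x + (fst q - fst p)) = a x"
    and "smooth1 b" "\<And>y. b (y + (snd q - snd p)) = b y"
  shows "smooth_periodic p q (\<lambda>z. a (fst z) * b (snd z))"
  using assms by (auto simp: smooth_periodic_def periodic_def smooth1_def C_k_prod)

lemma logistic_minus: "logistic (- x) = 1 - logistic x"
proof -
  have "1 + exp x \<noteq> 0" "exp x + 1 \<noteq> 0" using exp_gt_zero[of x] by linarith+
  then show ?thesis unfolding logistic_def by (simp add: exp_minus divide_simps)
qed

lemma logistic_scaled_tendsto:
  assumes "c > 0"
  shows "(\<lambda>n. logistic (real n * c)) \<longlonglongrightarrow> 1"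
proof -
  have "LIM n sequentially. - (real n * c) :> at_bot"
    using filterlim_tendsto_pos_mult_at_top[OF tendsto_const assms filterlim_real_sequentially]
    by (simp add: filterlim_uminus_at_bot mult.commute)
  then have "(\<lambda>n. exp (- (real n * c))) \<longlonglongrightarrow> 0" by (rule filterlim_compose[OF exp_at_bot])
  from tendsto_divide[OF tendsto_const[of 1] tendsto_add[OF tendsto_const[of 1] this]]
  show ?thesis unfolding logistic_def by simp
qed

text \<open>
  On one period the function \<open>x \<mapsto> cos (2 \<pi> (x - c) / L) - cos \<rho>\<close>, with \<open>c\<close> the midpoint of \<open>(a, b)\<close> and
  \<open>\<rho> = \<pi> (b - a) / L\<close>, is positive exactly on \<open>(a, b)\<close>. Composing large multiples of it with the logistic
  function gives smooth periodic functions that converge to the indicator of \<open>(a, b)\<close> away from its end points.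
\<close>

lemma periodic_interval_indicator_approx:
  assumes "l \<le> a" "a < b" "b \<le> r"
  obtains \<eta> :: "nat \<Rightarrow> real \<Rightarrow> real" where
    "\<And>n. smooth1 (\<eta> n)" "\<And>n x. \<eta> n (x + (r - l)) = \<eta> n x" "\<And>n x. 0 \<le> \<eta> n x" "\<And>n x. \<eta> n x \<le> 1"
    "\<And>x. l < x \<Longrightarrow> x < r \<Longrightarrow> x \<noteq> a \<Longrightarrow> x \<noteq> b \<Longrightarrow> (\<lambda>n. \<eta> n x) \<longlonglongrightarrow> indicator {a<..<b} x"
proof -
  define L where "L = r - l"
  have L: "L > 0" using assms by (simp add: L_def)
  define c where "c = (a + b) / 2"
  define \<rho> where "\<rho> = pi * (b - a) / L"
  define h where "h x = cos (2 * pi / L * x + (- (2 * pi / L * c))) + (- cos \<rho>)" for x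
  define \<eta> where "\<eta> n x = logistic (real n * h x)" for n x
  have "b - a \<le> L" using assms by (simp add: L_def)
  then have \<rho>: "0 < \<rho>" "\<rho> \<le> pi" using L assms mult_left_mono[of "b - a" L pi] by (auto simp: \<rho>_def pos_divide_le_eq)
  have K: "2 * pi / L > 0" using L by simp
  have \<rho>_alt: "\<rho> = 2 * pi / L * ((b - a) / 2)" "2 * pi - \<rho> = 2 * pi / L * (L - (b - a) / 2)"
    using L by (simp_all add: \<rho>_def field_simps)
  have h: "smooth1 h" unfolding h_def by (intro smooth1_add smooth1_cos_affine smooth1_const)
  have h_abs: "h x = cos (2 * pi / L * \<bar>x - c\<bar>) - cos \<rho>" for x
  proof -
    have "cos (2 * pi / L * \<bar>x - c\<bar>) = cos \<bar>2 * pi / L * (x - c)\<bar>" using L by (simp add: abs_mult)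
    then show ?thesis by (simp only: cos_abs_real) (simp add: h_def algebra_simps diff_divide_distrib)
  qed
  show thesis
  proof
    show "smooth1 (\<eta> n)" for n
      unfolding \<eta>_def by (intro smooth1_logistic_compose smooth1_mult smooth1_const h)
    have "h (x + L) = h x" for x
    proof -
      have "2 * pi / L * (x + L) + (- (2 * pi / L * c)) = (2 * pi / L * x + (- (2 * pi / L * c))) + 2 * pi"
        using L by (simp add: field_simps)
      then show ?thesis unfolding h_def by (simp only: cos_periodic)
    qed
    then show "\<eta> n (x + (r - l)) = \<eta> n x" for n x by (simp add: \<eta>_def L_def)
    show "0 \<le> \<eta> n x" "\<eta> n x \<le> 1" for n x using logistic_bounds by (auto simp: \<eta>_def less_imp_le)
    fix x assume x: "l < x" "x < r" "x \<noteq> a" "x \<noteq> b"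
    define \<theta> where "\<theta> = 2 * pi / L * \<bar>x - c\<bar>"
    show "(\<lambda>n. \<eta> n x) \<longlonglongrightarrow> indicator {a<..<b} x"
    proof (cases "x \<in> {a<..<b}")
      case True
      then have "\<bar>x - c\<bar> < (b - a) / 2" by (auto simp: c_def abs_if field_simps)
      then have "\<theta> < \<rho>" unfolding \<theta>_def \<rho>_alt using K by (rule mult_strict_left_mono)
      then have "h x > 0" using \<rho> L unfolding h_abs \<theta>_def[symmetric]
        by (simp add: cos_monotone_0_pi \<theta>_def)
      then have "(\<lambda>n. \<eta> n x) \<longlonglongrightarrow> 1" unfolding \<eta>_def by (rule logistic_scaled_tendsto)
      then show ?thesis using True by simp
    next
      case False
      then have "\<bar>x - c\<bar> > (b - a) / 2" "\<bar>x - c\<bar> < L - (b - a) / 2"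
        using x assms by (auto simp: c_def L_def abs_if field_simps)
      then have \<theta>: "\<rho> < \<theta>" "\<theta> < 2 * pi - \<rho>"
        unfolding \<rho>_alt(2) unfolding \<rho>_alt(1) \<theta>_def using K by (auto intro!: mult_strict_left_mono simp del: times_divide_eq_left)
      have "cos \<theta> < cos \<rho>"
      proof (cases "\<theta> \<le> pi")
        case True
        then show ?thesis using \<theta> \<rho> by (intro cos_monotone_0_pi) auto
      next
        case False
        then have "cos (2 * pi - \<theta>) < cos \<rho>" using \<theta> \<rho> by (intro cos_monotone_0_pi) auto
        then show ?thesis by simp
      qed
      then have "h x < 0" unfolding h_abs \<theta>_def[symmetric] by simp
      then have "(\<lambda>n. 1 - logistic (real n * - h x)) \<longlonglongrightarrow> 1 - 1"
        by (intro tendsto_diff tendsto_const logistic_scaled_tendsto) simp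
      then have "(\<lambda>n. \<eta> n x) \<longlonglongrightarrow> 0" by (simp add: \<eta>_def logistic_minus)
      then show ?thesis using False by simp
    qed
  qed
qed

text \<open>
  A periodic function has a periodic primitive once its mean is removed. The primitive that vanishes
  at the left end point is a difference of two numbers in \<open>[0, m]\<close>.
\<close>

lemma periodic_primitive:
  assumes \<eta>: "smooth1 \<eta>" "\<And>x. \<eta> (x + (r - l)) = \<eta> x" "\<And>x. 0 \<le> \<eta> x" and "l < r"
  defines "m \<equiv> integral {l..r} \<eta>"
  obtains a where "smooth1 a" "\<And>x. a (x + (r - l)) = a x"
    "\<And>x. (a has_real_derivative \<eta> x - m / (r - l)) (at x)"
    "\<And>x. l \<le> x \<Longrightarrow> x \<le> r \<Longrightarrow> \<bar>a x\<bar> \<le> m"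
proof -
  define L where "L = r - l"
  have L: "L > 0" "l + L = r" using assms by (simp_all add: L_def)
  have "\<exists>F. \<forall>x::real. - \<infinity> < ereal x \<longrightarrow> ereal x < \<infinity> \<longrightarrow> (F has_vector_derivative \<eta> x) (at x)"
    using smooth1_continuous[OF \<eta>(1), of UNIV]
    by (intro einterval_antiderivative) (auto simp: continuous_on_eq_continuous_at)
  then obtain F where F: "\<And>x. (F has_real_derivative \<eta> x) (at x)"
    by (auto simp: has_real_derivative_iff_has_vector_derivative)
  have m: "m = F r - F l"
    unfolding m_def using \<open>l < r\<close> F
    by (intro integral_unique fundamental_theorem_of_calculus)
      (auto simp: has_real_derivative_iff_has_vector_derivative intro: has_vector_derivative_at_within)
  have mono: "F x \<le> F y" if "x \<le> y" for x y
    using DERIV_nonneg_imp_nondecreasing[OF that, of F] F \<eta>(3) by blast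
  define a where "a x = F x - F l - (x - l) * (m / L)" for x
  have a': "(a has_real_derivative \<eta> x - m / L) (at x)" for x
    unfolding a_def using L by (auto intro!: derivative_eq_intros F)
  show thesis
  proof
    show "(a has_real_derivative \<eta> x - m / (r - l)) (at x)" for x using a' by (simp add: L_def)
    show "smooth1 a"
      using smooth1_add[OF \<eta>(1) smooth1_const[of "- (m / L)"]] by (intro smooth1_I[OF a']) simp
    show "a (x + (r - l)) = a x" for x
    proof -
      have "((\<lambda>x. a (x + L) - a x) has_real_derivative 0) (at x)" for x
        using DERIV_diff[OF DERIV_shift[THEN iffD1, OF a'[of "x + L"]] a'[of x]] \<eta>(2)[of x]
        by (simp add: L_def)
      then have "a (x + L) - a x = a (l + L) - a l"
        using DERIV_isconst_all[of "\<lambda>x. a (x + L) - a x" x l] by blast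
      also have "\<dots> = 0" using L by (simp add: a_def m flip: \<open>l + L = r\<close>)
      finally show ?thesis by (simp add: L_def)
    qed
    fix x assume x: "l \<le> x" "x \<le> r"
    have "0 \<le> m" unfolding m using mono \<open>l < r\<close> by simp
    have "0 \<le> (x - l) / L" "(x - l) / L \<le> 1" using x L by (auto simp: L_def)
    then have "0 \<le> (x - l) * (m / L)" "(x - l) * (m / L) \<le> m"
      using mult_left_le[of "(x - l) / L" m] \<open>0 \<le> m\<close> x L by (auto simp: mult.commute)
    moreover have "0 \<le> F x - F l" "F x - F l \<le> m" using mono x m by auto
    ultimately show "\<bar>a x\<bar> \<le> m" unfolding a_def by linarith
  qed
qed

section \<open>Integrable functions with non-negative integrals over boxes\<close>

text \<open>
  A bounded open set is a countable union of closed boxes with disjoint interiors, and the faces of the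
  boxes form a null set.
\<close>

lemma open_integral_nonneg:
  fixes g :: "'a::euclidean_space \<Rightarrow> real"
  assumes int: "integrable lborel g" and box: "\<And>a b. (LINT x:box a b|lborel. g x) \<ge> 0"
    and S: "open S" "bounded S"
  shows "(LINT x:S|lborel. g x) \<ge> 0"
proof (cases "S = {}")
  case False
  obtain a where "S \<subseteq> box (-a) a"
    using bounded_subset_box_symmetric[OF S(2)] by blast
  with False have a: "S \<subseteq> cbox (-a) a" "box (-a) a \<noteq> {}"
    using box_subset_cbox[of "-a" a] by auto
  \<comment> \<open>With this gauge every box of the covering lemma lies inside \<open>S\<close>.\<close>
  have gau: "gauge (\<lambda>x. if x \<in> S then S else UNIV)"
    using S by (auto simp: gauge_def)
  obtain D where D: "countable D" "\<And>K. K \<in> D \<Longrightarrow> interior K \<noteq> {} \<and> (\<exists>c d. K = cbox c d)"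
    "pairwise (\<lambda>A B. interior A \<inter> interior B = {}) D"
    "\<And>K. K \<in> D \<Longrightarrow> \<exists>x \<in> S \<inter> K. K \<subseteq> (if x \<in> S then S else UNIV)" "S \<subseteq> \<Union>D"
    by (rule covering_lemma[OF a gau]) blast
  have SD: "S = \<Union>D" using D(4,5) by fastforce
  \<comment> \<open>The interiors are enumerated through the injection of \<open>D\<close> into the naturals, with empty sets at unused indices, so that the family is disjoint even for finite \<open>D\<close>.\<close>
  define A where "A n = (if n \<in> to_nat_on D ` D then interior (from_nat_into D n) else {})" for n
  have Abox: "\<exists>c d. A n = box c d" for n
  proof (cases "n \<in> to_nat_on D ` D")
    case True
    then have "from_nat_into D n \<in> D" using D(1) by auto
    then show ?thesis using D(2) True unfolding A_def by (metis interior_cbox)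
  next
    case False
    then show ?thesis unfolding A_def by (intro exI[of _ 0]) simp
  qed
  have disj: "disjoint_family A"
    unfolding disjoint_family_on_def
  proof (intro ballI impI)
    fix m n :: nat assume "m \<noteq> n"
    show "A m \<inter> A n = {}"
    proof (cases "m \<in> to_nat_on D ` D \<and> n \<in> to_nat_on D ` D")
      case True
      then obtain K L where "K \<in> D" "L \<in> D" "m = to_nat_on D K" "n = to_nat_on D L" by auto
      moreover from this \<open>m \<noteq> n\<close> have "K \<noteq> L" by auto
      ultimately show ?thesis using D(1,3) by (simp add: A_def pairwise_def)
    qed (auto simp: A_def)
  qed
  have UA: "(\<Union>n. A n) = (\<Union>K\<in>D. interior K)"
  proof (intro equalityI subsetI)
    fix x assume "x \<in> (\<Union>n. A n)"
    then show "x \<in> (\<Union>K\<in>D. interior K)" using D(1) by (auto simp: A_def split: if_splits)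
  next
    fix x assume "x \<in> (\<Union>K\<in>D. interior K)"
    then obtain K where "K \<in> D" "x \<in> interior K" by blast
    then have "x \<in> A (to_nat_on D K)" using D(1) by (simp add: A_def)
    then show "x \<in> (\<Union>n. A n)" by blast
  qed
  have nullF: "(\<Union>K\<in>D. frontier K) \<in> null_sets lborel"
  proof (rule null_sets_UN')
    show "countable D" by fact
    fix K assume "K \<in> D"
    then obtain c d where K: "K = cbox c d" using D(2) by blast
    have "negligible (frontier K)" unfolding K by (simp add: negligible_frontier_interval frontier_cbox)
    then have "frontier K \<in> null_sets lebesgue" by (simp add: negligible_iff_null_sets)
    then show "frontier K \<in> null_sets lborel"
      by (metis borel_closed frontier_closed null_sets_completion_iff sets_lborel)
  qed
  have Am: "A n \<in> sets lborel" for n using Abox[of n] by auto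
  have "(LINT x:S|lborel. g x) = (LINT x:(\<Union>n. A n)|lborel. g x)"
  proof (rule set_integral_cong_set[symmetric])
    show "set_borel_measurable lborel S g" "set_borel_measurable lborel (\<Union>n. A n) g"
      using S int Am by (auto simp: set_borel_measurable_def intro!: borel_measurable_times borel_measurable_indicator)
    have "AE x in lborel. x \<notin> (\<Union>K\<in>D. frontier K)" using nullF by (rule AE_not_in)
    then show "AE x in lborel. (x \<in> S) = (x \<in> (\<Union>n. A n))"
    proof eventually_elim
      case (elim x)
      have "x \<in> K \<longleftrightarrow> x \<in> interior K" if "K \<in> D" for K
      proof -
        have "closure K = K" using D(2)[OF that] closed_cbox closure_closed by metis
        then show ?thesis using elim that interior_subset by (auto simp: frontier_def)
      qed
      then show ?case unfolding UA SD by auto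
    qed
  qed
  also have "\<dots> \<ge> 0"
  proof (rule LIMSEQ_le_const)
    have gA: "set_integrable lborel B g" if "B \<in> sets lborel" for B
      using that int unfolding set_integrable_def by (rule integrable_mult_indicator)
    have "(\<Union>n. \<Union>i<n. A i) = (\<Union>n. A n)" by auto
    moreover have "(\<lambda>n. LINT x:(\<Union>i<n. A i)|lborel. g x) \<longlonglongrightarrow> (LINT x:(\<Union>n. \<Union>i<n. A i)|lborel. g x)"
      by (rule set_integral_cont_up) (use Am in \<open>auto simp: incseq_def intro!: gA, force\<close>)
    ultimately show "(\<lambda>n. LINT x:(\<Union>i<n. A i)|lborel. g x) \<longlonglongrightarrow> (LINT x:(\<Union>n. A n)|lborel. g x)"
      by simp
    have "(LINT x:(\<Union>i<n. A i)|lborel. g x) = (\<Sum>i<n. LINT x:A i|lborel. g x)" for n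
      using disj Am gA by (intro set_integral_finite_Union) (auto simp: disjoint_family_on_def)
    moreover have "0 \<le> (LINT x:A n|lborel. g x)" for n using box Abox[of n] by metis
    ultimately show "\<exists>N. \<forall>n\<ge>N. 0 \<le> (LINT x:(\<Union>i<n. A i)|lborel. g x)"
      by (auto intro!: sum_nonneg)
  qed
  finally show ?thesis .
qed (simp add: set_lebesgue_integral_def)

text \<open>
  The finite measure with density \<open>\<bar>g\<bar>\<close> is outer regular, so the set \<open>A\<close> where \<open>g < 0\<close> lies in an open set
  \<open>V\<close> that carries little more of this measure than \<open>A\<close> does. As \<open>g\<close> has a non-negative integral over \<open>V\<close>,
  its integral over \<open>A\<close> cannot be negative.
\<close>

lemma AE_nonneg_if_box_integrals_nonneg:
  fixes g :: "'a::euclidean_space \<Rightarrow> real"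
  assumes int: "integrable lborel g" and box: "\<And>a b. (LINT x:box a b|lborel. g x) \<ge> 0"
    and supp: "\<And>x. x \<notin> box p q \<Longrightarrow> g x = 0"
  shows "AE x in lborel. 0 \<le> g x"
proof -
  have gA: "set_integrable lborel B g" if "B \<in> sets lborel" for B
    using that int unfolding set_integrable_def by (rule integrable_mult_indicator)
  have [measurable]: "g \<in> borel_measurable borel" using int by auto
  define A where "A = {x. g x < 0}"
  define M where "M = density lborel (\<lambda>x. ennreal \<bar>g x\<bar>)"
  have [measurable]: "A \<in> sets borel" unfolding A_def by measurable
  have Aint: "set_integrable lborel A g" using gA by auto
  have emM: "emeasure M B = ennreal (LINT x:B|lborel. \<bar>g x\<bar>)" if "B \<in> sets borel" for B
  proof -
    have "emeasure M B = (\<integral>\<^sup>+ x. ennreal (indicator B x * \<bar>g x\<bar>) \<partial>lborel)"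
      using that unfolding M_def by (subst emeasure_density)
        (auto intro!: nn_integral_cong split: split_indicator)
    also have "\<dots> = ennreal (LINT x|lborel. indicator B x * \<bar>g x\<bar>)"
      using that integrable_real_mult_indicator[OF _ integrable_abs[OF int], of B]
      by (intro nn_integral_eq_integral) (auto simp: mult.commute)
    finally show ?thesis by (simp add: set_lebesgue_integral_def)
  qed
  have sets_M: "sets M = sets borel" and spM: "space M = UNIV" by (auto simp: M_def)
  have outer: "emeasure M A = (INF U \<in> {U. A \<subseteq> U \<and> open U}. emeasure M U)"
    by (rule outer_regular) (auto simp: sets_M spM emM)
  have "- (LINT x:A|lborel. g x) \<le> 0 + e" if "e > 0" for e
  proof -
    have "emeasure M A < emeasure M A + ennreal e"
      using that by (simp add: emM)
    then have "(INF U \<in> {U. A \<subseteq> U \<and> open U}. emeasure M U) < emeasure M A + ennreal e"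
      by (simp flip: outer)
    then obtain U where U: "A \<subseteq> U" "open U" "emeasure M U < emeasure M A + ennreal e"
      unfolding INF_less_iff by blast
    define V where "V = U \<inter> box p q"
    have V: "open V" "bounded V" "A \<subseteq> V" "V \<subseteq> U"
      using U supp bounded_subset[OF bounded_box[of p q]] by (force simp: V_def A_def)+
    have "emeasure M V \<le> emeasure M U" using V U by (intro emeasure_mono) (auto simp: sets_M)
    with U have "emeasure M V < emeasure M A + ennreal e" by order
    moreover have "0 \<le> (LINT x:A|lborel. \<bar>g x\<bar>)" "0 \<le> (LINT x:V|lborel. \<bar>g x\<bar>)"
      by (auto simp: set_lebesgue_integral_def)
    ultimately have *: "(LINT x:V|lborel. \<bar>g x\<bar>) < (LINT x:A|lborel. \<bar>g x\<bar>) + e"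
      using V that by (simp add: emM ennreal_less_iff flip: ennreal_plus)
    have "(LINT x:A|lborel. \<bar>g x\<bar>) = - (LINT x:A|lborel. g x)"
      unfolding set_integral_uminus[OF Aint, symmetric]
      by (rule set_lebesgue_integral_cong) (auto simp: A_def)
    moreover have "0 \<le> (LINT x:V|lborel. g x)"
      by (rule open_integral_nonneg[OF int box V(1,2)])
    moreover have "(LINT x:V|lborel. g x) \<le> (LINT x:V|lborel. \<bar>g x\<bar>) + 2 * (LINT x:A|lborel. g x)"
    proof -
      have "(LINT x:V|lborel. g x) = (LINT x|lborel. indicator V x * \<bar>g x\<bar> + 2 * (indicator A x * g x))"
        unfolding set_lebesgue_integral_def using V(3)
        by (intro Bochner_Integration.integral_cong) (auto simp: A_def split: split_indicator)
      also have "\<dots> = (LINT x:V|lborel. \<bar>g x\<bar>) + 2 * (LINT x:A|lborel. g x)"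
        unfolding set_lebesgue_integral_def
        using set_integrable_abs[OF gA[of V]] Aint V(1)
        by (subst Bochner_Integration.integral_add) (auto simp: set_integrable_def)
      finally show ?thesis by simp
    qed
    ultimately show ?thesis using * by linarith
  qed
  then have ge0: "- (LINT x:A|lborel. g x) \<le> 0" by (rule field_le_epsilon)
  have "AE x in lborel. indicator A x * g x = 0"
  proof -
    have "(LINT x|lborel. - (indicator A x * g x)) = 0"
    proof (rule antisym)
      show "(LINT x|lborel. - (indicator A x * g x)) \<le> 0"
        using ge0 by (simp add: set_lebesgue_integral_def)
      show "0 \<le> (LINT x|lborel. - (indicator A x * g x))"
        by (rule integral_nonneg_AE) (auto simp: A_def split: split_indicator)
    qed
    then have "AE x in lborel. - (indicator A x * g x) = 0"
      using Aint by (subst (asm) integral_nonneg_eq_0_iff_AE)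
       (auto simp: A_def set_integrable_def split: split_indicator)
    then show ?thesis by auto
  qed
  then show ?thesis by eventually_elim (auto simp: A_def split: split_indicator_asm)
qed

section \<open>Integration over the plane and its slices\<close>

lemma borel_measurable_fst_snd [measurable (raw)]:
  fixes f :: "real \<Rightarrow> real"
  assumes "f \<in> borel_measurable borel"
  shows "(\<lambda>z::real \<times> real. f (fst z)) \<in> borel_measurable borel"
    and "(\<lambda>z::real \<times> real. f (snd z)) \<in> borel_measurable borel"
proof -
  have "fst \<in> borel_measurable (borel :: (real \<times> real) measure)" "snd \<in> borel_measurable (borel :: (real \<times> real) measure)"
    by (auto intro!: borel_measurable_continuous_onI continuous_intros)
  then show "(\<lambda>z::real \<times> real. f (fst z)) \<in> borel_measurable borel"
    "(\<lambda>z::real \<times> real. f (snd z)) \<in> borel_measurable borel"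
    using assms by (auto intro: measurable_compose)
qed

lemma integrable_tensor_product:
  fixes f g :: "real \<Rightarrow> real"
  assumes f: "integrable lborel f" and g: "integrable lborel g"
  shows "integrable lborel (\<lambda>z. f (fst z) * g (snd z))"
    and "(LINT z|lborel. f (fst z) * g (snd z)) = (LINT x|lborel. f x) * (LINT y|lborel. g y)"
proof -
  have [measurable]: "f \<in> borel_measurable borel" "g \<in> borel_measurable borel" using f g by auto
  show *: "integrable lborel (\<lambda>z. f (fst z) * g (snd z))"
    unfolding lborel_prod[symmetric]
  proof (rule lborel_pair.Fubini_integrable)
    show "integrable lborel (\<lambda>x. LINT y|lborel. norm (f (fst (x, y)) * g (snd (x, y))))"
      using f by (simp add: abs_mult)
  qed (use g in auto)
  have "(LINT z|lborel. f (fst z) * g (snd z)) = (LINT x|lborel. (LINT y|lborel. f x * g y))"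
    using lborel_pair.integral_fst'[of "\<lambda>z. f (fst z) * g (snd z)"] * by (simp add: lborel_prod)
  also have "\<dots> = (LINT x|lborel. f x) * (LINT y|lborel. g y)" by simp
  finally show "(LINT z|lborel. f (fst z) * g (snd z)) = (LINT x|lborel. f x) * (LINT y|lborel. g y)" .
qed

lemma integrable_mult_bounded:
  fixes U h :: "'a \<Rightarrow> real"
  assumes "integrable M U" "h \<in> borel_measurable M" "\<And>x. x \<in> space M \<Longrightarrow> U x \<noteq> 0 \<Longrightarrow> \<bar>h x\<bar> \<le> C"
  shows "integrable M (\<lambda>x. U x * h x)"
proof (rule Bochner_Integration.integrable_bound[of _ "\<lambda>x. C * U x"])
  show "AE x in M. norm (U x * h x) \<le> norm (C * U x)"
  proof (rule AE_I2)
    fix x assume "x \<in> space M"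
    then have "U x \<noteq> 0 \<Longrightarrow> \<bar>h x\<bar> \<le> \<bar>C\<bar>" using assms(3)[of x] by linarith
    then show "norm (U x * h x) \<le> norm (C * U x)"
      by (cases "U x = 0") (auto simp: abs_mult mult.commute intro: mult_right_mono)
  qed
qed (use assms in auto)

lemma indicator_box_prod:
  fixes a b z :: "real \<times> real"
  shows "indicator (box a b) z = (indicator {fst a<..<fst b} (fst z) * indicator {snd a<..<snd b} (snd z) :: real)"
  by (cases z, cases a, cases b) (auto simp: box_def Basis_prod_def split: split_indicator)

lemma integral_Pair:
  fixes f g :: "'a \<Rightarrow> real"
  assumes "integrable M f" "integrable M g"
  shows "(LINT x|M. (f x, g x)) = (LINT x|M. f x, LINT x|M. g x)"
proof -
  have "(LINT x|M. (f x, g x)) = (LINT x|M. f x *\<^sub>R (1, 0) + g x *\<^sub>R (0, 1))"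
    by (intro Bochner_Integration.integral_cong) auto
  also have "\<dots> = (LINT x|M. f x *\<^sub>R (1, 0)) + (LINT x|M. g x *\<^sub>R (0, 1))"
    using assms by (intro Bochner_Integration.integral_add integrable_scaleR_left) auto
  also have "\<dots> = (LINT x|M. f x, LINT x|M. g x)"
    using integral_scaleR_left[of "(1::real, 0::real)" M f] integral_scaleR_left[of "(0::real, 1::real)" M g] assms
    by simp
  finally show ?thesis .
qed

lemma integrable_mult_continuous:
  fixes U :: "'a::euclidean_space \<Rightarrow> real"
  assumes "integrable lborel U" "\<And>z. z \<notin> box p q \<Longrightarrow> U z = 0" "continuous_on UNIV h"
  shows "integrable lborel (\<lambda>z. U z * h z)"
proof -
  have "compact (h ` cbox p q)"
    using assms(3) continuous_on_subset by (intro compact_continuous_image) auto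
  then obtain C where C: "\<forall>z\<in>cbox p q. \<bar>h z\<bar> \<le> C"
    by (auto dest!: compact_imp_bounded simp: bounded_iff)
  show ?thesis
  proof (rule integrable_mult_bounded[where C = C])
    fix z assume "U z \<noteq> 0"
    then show "\<bar>h z\<bar> \<le> C" using assms(2)[of z] C box_subset_cbox[of p q] by auto
  qed (use assms in \<open>auto intro: borel_measurable_continuous_onI\<close>)
qed

lemma integrable_of_square_integrable:
  fixes U :: "'a::euclidean_space \<Rightarrow> real"
  assumes "U \<in> borel_measurable lborel" "integrable lborel (\<lambda>z. (U z)\<^sup>2)" "\<And>z. z \<notin> box p q \<Longrightarrow> U z = 0"
  shows "integrable lborel U"
proof (rule Bochner_Integration.integrable_bound[of _ "\<lambda>z. indicator (box p q) z + (U z)\<^sup>2"])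
  have "integrable lborel (indicator (box p q) :: 'a \<Rightarrow> real)"
    by (rule integrable_real_indicator) (auto simp: emeasure_lborel_box_eq)
  then show "integrable lborel (\<lambda>z. indicator (box p q) z + (U z)\<^sup>2)" using assms by simp
  have "\<bar>x\<bar> \<le> 1 + x\<^sup>2" for x :: real
    using zero_le_power2[of "\<bar>x\<bar> - 1"] by (simp add: power2_diff)
  then show "AE z in lborel. norm (U z) \<le> norm (indicator (box p q) z + (U z)\<^sup>2)"
    using assms(3) by (intro AE_I2) (auto split: split_indicator)
qed (use assms in auto)

lemma integrable_mult_of_square_integrable:
  fixes f g :: "'a \<Rightarrow> real"
  assumes "f \<in> borel_measurable M" "g \<in> borel_measurable M"
    "integrable M (\<lambda>z. (f z)\<^sup>2)" "integrable M (\<lambda>z. (g z)\<^sup>2)"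
  shows "integrable M (\<lambda>z. f z * g z)"
proof (rule Bochner_Integration.integrable_bound[of _ "\<lambda>z. (f z)\<^sup>2 + (g z)\<^sup>2"])
  have "\<bar>x * y\<bar> \<le> x\<^sup>2 + y\<^sup>2" for x y :: real
  proof -
    have "2 * \<bar>x\<bar> * \<bar>y\<bar> \<le> x\<^sup>2 + y\<^sup>2" using sum_squares_bound[of "\<bar>x\<bar>" "\<bar>y\<bar>"] by simp
    moreover have "0 \<le> \<bar>x\<bar> * \<bar>y\<bar>" by simp
    ultimately show ?thesis unfolding abs_mult by linarith
  qed
  then show "AE z in M. norm (f z * g z) \<le> norm ((f z)\<^sup>2 + (g z)\<^sup>2)" by simp
qed (use assms in auto)

text \<open>
  On almost every line the Cauchy-Schwarz inequality bounds the square of the integral by the length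
  of the interval times the integral of the square.
\<close>

lemma slice_integral_square_integrable:
  fixes h :: "real \<times> real \<Rightarrow> real"
  assumes pq: "fst p < fst q" and h: "h \<in> borel_measurable lborel" "integrable lborel (\<lambda>z. (h z)\<^sup>2)"
    "\<And>z. z \<notin> box p q \<Longrightarrow> h z = 0"
  shows "integrable lborel (\<lambda>y. (LINT x|lborel. h (x, y))\<^sup>2)"
proof -
  define L where "L = fst q - fst p"
  have L: "L > 0" using pq by (simp add: L_def)
  have hi: "integrable lborel h" using h by (rule integrable_of_square_integrable)
  have h2: "integrable (lborel \<Otimes>\<^sub>M lborel) (\<lambda>(x, y). (h (x, y))\<^sup>2)" "integrable (lborel \<Otimes>\<^sub>M lborel) (\<lambda>(x, y). h (x, y))"
    using h hi by (simp_all add: lborel_prod case_prod_beta')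
  have ind: "integrable lborel (indicator {fst p<..<fst q} :: real \<Rightarrow> real)"
    "(LINT x|lborel. indicator {fst p<..<fst q} x) = L"
    using pq by (auto simp: L_def intro!: integrable_real_indicator)
  have h0: "h (x, y) = 0" if "x \<notin> {fst p<..<fst q}" for x y
    using that h(3)[of "(x, y)"] indicator_box_prod[of p q "(x, y)"] by (auto split: split_indicator_asm)
  show ?thesis
  proof (rule Bochner_Integration.integrable_bound)
    show "integrable lborel (\<lambda>y. L * (LINT x|lborel. (h (x, y))\<^sup>2))"
      using lborel_pair.integrable_snd[OF h2(1)] by simp
    show "(\<lambda>y. (LINT x|lborel. h (x, y))\<^sup>2) \<in> borel_measurable lborel"
      using lborel_pair.integrable_snd[OF h2(2)] by (intro borel_measurable_power) auto
    have "AE y in lborel. integrable lborel (\<lambda>x. (h (x, y))\<^sup>2)" "AE y in lborel. integrable lborel (\<lambda>x. h (x, y))"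
      using lborel_pair.AE_integrable_snd[OF h2(1)] lborel_pair.AE_integrable_snd[OF h2(2)] by auto
    then show "AE y in lborel. norm ((LINT x|lborel. h (x, y))\<^sup>2) \<le> norm (L * (LINT x|lborel. (h (x, y))\<^sup>2))"
    proof eventually_elim
      case (elim y)
      define f where "f = (LINT x|lborel. h (x, y))"
      \<comment> \<open>The variance of the slice about its mean \<open>f / L\<close> is non-negative.\<close>
      have "0 \<le> (LINT x|lborel. ((h (x, y))\<^sup>2 - 2 * (f / L) * h (x, y)) + (f / L)\<^sup>2 * indicator {fst p<..<fst q} x)"
      proof (rule integral_nonneg_AE, rule AE_I2)
        fix x
        show "0 \<le> ((h (x, y))\<^sup>2 - 2 * (f / L) * h (x, y)) + (f / L)\<^sup>2 * indicator {fst p<..<fst q} x"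
          using zero_le_power2[of "h (x, y) - f / L"] h0[of x y]
          by (auto simp: power2_diff algebra_simps split: split_indicator)
      qed
      also have "\<dots> = (LINT x|lborel. (h (x, y))\<^sup>2) - 2 * (f / L) * f + (f / L)\<^sup>2 * L"
        using elim ind by (simp add: f_def)
      also have "\<dots> = (LINT x|lborel. (h (x, y))\<^sup>2) - f\<^sup>2 / L"
        using L by (simp add: power2_eq_square field_simps)
      finally have "f\<^sup>2 \<le> L * (LINT x|lborel. (h (x, y))\<^sup>2)" using L by (simp add: field_simps)
      then show ?case unfolding f_def by simp
    qed
  qed
qed

section \<open>Embedding of periodic \<open>H\<^sup>1\<close> into \<open>L\<^sup>4\<close>\<close>

text \<open>
  The function \<open>f\<close> is the envelope in the variable \<open>y\<close> of a function \<open>U\<close> with weak \<open>x\<close>-derivative \<open>H\<close>: the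
  mean of \<open>\<bar>U\<bar>\<close> over the horizontal line through \<open>y\<close> plus the integral of \<open>\<bar>H\<bar>\<close> over it.
\<close>

lemma slice_envelope:
  fixes U H :: "real \<times> real \<Rightarrow> real" and p q :: "real \<times> real"
  assumes "fst p < fst q" "snd p < snd q"
    and U: "integrable lborel U" "\<forall>z. z \<notin> box p q \<longrightarrow> U z = 0"
    and H: "integrable lborel H" "\<forall>z. z \<notin> box p q \<longrightarrow> H z = 0"
  defines "f \<equiv> \<lambda>y. LINT x|lborel. \<bar>U (x, y)\<bar> / (fst q - fst p) + \<bar>H (x, y)\<bar>"
  shows "integrable lborel f" "\<And>y. 0 \<le> f y" "\<And>y. y \<notin> {snd p<..<snd q} \<Longrightarrow> f y = 0"
    and "\<And>\<xi>. continuous_on UNIV \<xi> \<Longrightarrow> (\<And>y. \<bar>\<xi> y\<bar> \<le> C) \<Longrightarrow>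
      (LINT y|lborel. f y * \<xi> y) = (LINT z|lborel. (\<bar>U z\<bar> / (fst q - fst p) + \<bar>H z\<bar>) * \<xi> (snd z))"
proof -
  let ?g = "\<lambda>z. \<bar>U z\<bar> / (fst q - fst p) + \<bar>H z\<bar>"
  have g: "integrable lborel ?g" using U(1) H(1) by auto
  then show "integrable lborel f"
    unfolding f_def lborel_prod[symmetric]
    using lborel_pair.integrable_snd[of "\<lambda>x y. ?g (x, y)"] by (simp add: case_prod_beta')
  show "0 \<le> f y" for y using assms(1) by (auto simp: f_def intro!: integral_nonneg_AE)
  show "f y = 0" if "y \<notin> {snd p<..<snd q}" for y
  proof -
    have "(x, y) \<notin> box p q" for x
      using that indicator_box_prod[of p q "(x, y)"] by (auto split: split_indicator_asm)
    then show ?thesis using U H by (simp add: f_def)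
  qed
  fix \<xi> :: "real \<Rightarrow> real" assume \<xi>: "continuous_on UNIV \<xi>" "\<And>y. \<bar>\<xi> y\<bar> \<le> C"
  have [measurable]: "\<xi> \<in> borel_measurable borel" using \<xi> by (simp add: borel_measurable_continuous_onI)
  have [measurable]: "(\<lambda>z::real \<times> real. \<xi> (snd z)) \<in> borel_measurable borel"
    by (rule borel_measurable_fst_snd) measurable
  have "integrable lborel (\<lambda>z. ?g z * \<xi> (snd z))"
    using g \<xi> by (intro integrable_mult_bounded[where C = C]) auto
  then have "(LINT z|lborel. ?g z * \<xi> (snd z)) = (LINT y|lborel. (LINT x|lborel. ?g (x, y) * \<xi> y))"
    using lborel_pair.integral_snd[of "\<lambda>x y. ?g (x, y) * \<xi> y"] by (simp add: lborel_prod case_prod_beta')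
  then show "(LINT y|lborel. f y * \<xi> y) = (LINT z|lborel. ?g z * \<xi> (snd z))"
    by (simp add: f_def)
qed

text \<open>
  For smooth periodic \<open>\<eta>, \<xi>\<close> with values in \<open>[0, 1]\<close> let \<open>m\<close> be the integral of \<open>\<eta>\<close> over a period of length
  \<open>L\<close>, and \<open>a\<close> the periodic primitive of \<open>\<eta> - m / L\<close>. Testing with \<open>a(x) \<xi>(y)\<close> and using \<open>\<bar>a\<bar> \<le> m\<close> bounds the
  integral of \<open>U \<eta> \<xi>\<close> by \<open>m\<close> times the integral of \<open>f \<xi>\<close>, which is the integral of \<open>f(y) \<eta>(x) \<xi>(y)\<close>.
  Letting \<open>\<eta>\<close> and \<open>\<xi>\<close> tend to indicators of intervals shows that \<open>f(y) - U\<close> has non-negative integrals over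
  boxes.
\<close>

lemma weak_derivative_slice_bound:
  fixes U H :: "real \<times> real \<Rightarrow> real" and p q :: "real \<times> real"
  assumes pq: "fst p < fst q" "snd p < snd q"
    and U: "integrable lborel U" "\<And>z. z \<notin> box p q \<Longrightarrow> U z = 0"
    and H: "integrable lborel H" "\<And>z. z \<notin> box p q \<Longrightarrow> H z = 0"
    and weak: "\<And>a a' b. smooth1 a \<Longrightarrow> (\<And>x. (a has_real_derivative a' x) (at x)) \<Longrightarrow>
       (\<And>x. a (x + (fst q - fst p)) = a x) \<Longrightarrow> smooth1 b \<Longrightarrow> (\<And>y. b (y + (snd q - snd p)) = b y) \<Longrightarrow>
       (LINT z|lborel. U z * (a' (fst z) * b (snd z))) = - (LINT z|lborel. H z * (a (fst z) * b (snd z)))"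
  defines "f \<equiv> \<lambda>y. LINT x|lborel. \<bar>U (x, y)\<bar> / (fst q - fst p) + \<bar>H (x, y)\<bar>"
  shows "AE z in lborel. U z \<le> f (snd z)"
proof -
  define L where "L = fst q - fst p"
  have L: "L > 0" using pq by (simp add: L_def)
  have "\<forall>z. z \<notin> box p q \<longrightarrow> U z = 0" "\<forall>z. z \<notin> box p q \<longrightarrow> H z = 0" using U(2) H(2) by blast+
  note slice = slice_envelope[OF pq U(1) this(1) H(1) this(2)]
  have f: "integrable lborel f" "\<And>y. 0 \<le> f y" "\<And>y. y \<notin> {snd p<..<snd q} \<Longrightarrow> f y = 0"
    "\<And>\<xi> C. continuous_on UNIV \<xi> \<Longrightarrow> (\<And>y. \<bar>\<xi> y\<bar> \<le> C) \<Longrightarrow>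
      (LINT y|lborel. f y * \<xi> y) = (LINT z|lborel. (\<bar>U z\<bar> / L + \<bar>H z\<bar>) * \<xi> (snd z))"
    unfolding f_def L_def using slice by blast+
  have [measurable]: "f \<in> borel_measurable borel" "U \<in> borel_measurable borel" using f(1) U by auto
  define g where "g z = indicator {fst p<..<fst q} (fst z) * f (snd z) - U z" for z
  have fprod: "integrable lborel (\<lambda>z. indicator {fst p<..<fst q} (fst z) * f (snd z))"
    by (rule integrable_tensor_product(1)[OF _ f(1)]) (use pq in \<open>auto intro!: integrable_real_indicator\<close>)
  then have g: "integrable lborel g" unfolding g_def using U by auto
  have g0: "g z = 0" if "z \<notin> box p q" for z
    using that U(2) f(3)[of "snd z"] indicator_box_prod[of p q z] by (auto simp: g_def split: split_indicator_asm)
  have smooth_test: "0 \<le> (LINT z|lborel. g z * (\<eta> (fst z) * \<xi> (snd z)))"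
    if \<eta>: "smooth1 \<eta>" "\<And>x. \<eta> (x + (fst q - fst p)) = \<eta> x" "\<And>x. 0 \<le> \<eta> x" "\<And>x. \<eta> x \<le> 1"
      and \<xi>: "smooth1 \<xi>" "\<And>y. \<xi> (y + (snd q - snd p)) = \<xi> y" "\<And>y. 0 \<le> \<xi> y" "\<And>y. \<xi> y \<le> 1" for \<eta> \<xi>
  proof -
    have [measurable]: "\<eta> \<in> borel_measurable borel" "\<xi> \<in> borel_measurable borel"
      using \<eta> \<xi> smooth1_continuous by (auto intro!: borel_measurable_continuous_onI)
    define m where "m = integral {fst p..fst q} \<eta>"
    obtain a where a: "smooth1 a" "\<And>x. a (x + (fst q - fst p)) = a x"
      "\<And>x. (a has_real_derivative \<eta> x - m / (fst q - fst p)) (at x)"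
      "\<And>x. fst p \<le> x \<Longrightarrow> x \<le> fst q \<Longrightarrow> \<bar>a x\<bar> \<le> m"
      unfolding m_def by (rule periodic_primitive[OF \<eta>(1,2,3) pq(1)]) auto
    have [measurable]: "a \<in> borel_measurable borel"
      using a smooth1_continuous by (auto intro!: borel_measurable_continuous_onI)
    have "0 \<le> m" using a(4)[of "fst p"] pq by simp
    have m: "(LINT x|lborel. indicator {fst p<..<fst q} x * \<eta> x) = m"
    proof -
      have "integrable lborel (\<lambda>x. indicator {fst p..fst q} x *\<^sub>R \<eta> x)"
        by (rule borel_integrable_compact) (use smooth1_continuous \<eta> in auto)
      then have "(LINT x:{fst p..fst q}|lborel. \<eta> x) = m"
        unfolding m_def by (intro set_borel_integral_eq_integral) (simp add: set_integrable_def)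
      moreover have "(LINT x:{fst p..fst q}|lborel. \<eta> x) = (LINT x:{fst p<..<fst q}|lborel. \<eta> x)"
      proof (rule set_integral_cong_set[symmetric])
        have "AE x in lborel. x \<noteq> fst p" "AE x in lborel. x \<noteq> fst q" by (rule AE_lborel_singleton)+
        then show "AE x in lborel. (x \<in> {fst p..fst q}) = (x \<in> {fst p<..<fst q})"
          by eventually_elim auto
      qed (auto simp: set_borel_measurable_def)
      ultimately show ?thesis by (simp add: set_lebesgue_integral_def)
    qed
    have box_fst: "fst p \<le> fst z \<and> fst z \<le> fst q" if "z \<in> box p q" for z
      using that indicator_box_prod[of p q z] by (auto split: split_indicator_asm)
    have i1: "integrable lborel (\<lambda>z. U z * (\<eta> (fst z) * \<xi> (snd z)))"
      using \<eta> \<xi> by (intro integrable_mult_bounded[where C = 1] U) (auto simp: abs_mult mult_le_one)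
    have i2: "integrable lborel (\<lambda>z. U z * \<xi> (snd z))"
      using \<xi> by (intro integrable_mult_bounded[where C = 1] U) auto
    have i3: "integrable lborel (\<lambda>z. H z * (a (fst z) * \<xi> (snd z)))"
    proof (rule integrable_mult_bounded[where C = m])
      fix z assume "H z \<noteq> 0"
      then have "\<bar>a (fst z)\<bar> \<le> m" using H(2) box_fst a(4) by blast
      then show "\<bar>a (fst z) * \<xi> (snd z)\<bar> \<le> m"
        using \<xi>(3,4)[of "snd z"] mult_mono[of "\<bar>a (fst z)\<bar>" m "\<xi> (snd z)" 1] \<open>0 \<le> m\<close> by (simp add: abs_mult)
    qed (use H in auto)
    have i4: "integrable lborel (\<lambda>z. (\<bar>U z\<bar> / L + \<bar>H z\<bar>) * \<xi> (snd z))"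
      using \<xi> U H by (intro integrable_mult_bounded[where C = 1]) auto
    have i5: "integrable lborel (\<lambda>z. (indicator {fst p<..<fst q} (fst z) * f (snd z)) * (\<eta> (fst z) * \<xi> (snd z)))"
      using \<eta> \<xi> by (intro integrable_mult_bounded[where C = 1] fprod) (auto simp: abs_mult mult_le_one)
    have "(LINT z|lborel. U z * ((\<eta> (fst z) - m / L) * \<xi> (snd z))) = - (LINT z|lborel. H z * (a (fst z) * \<xi> (snd z)))"
      unfolding L_def by (rule weak[OF a(1,3,2) \<xi>(1,2)])
    moreover have "(LINT z|lborel. U z * ((\<eta> (fst z) - m / L) * \<xi> (snd z)))
      = (LINT z|lborel. U z * (\<eta> (fst z) * \<xi> (snd z)) - m / L * (U z * \<xi> (snd z)))"
      by (intro Bochner_Integration.integral_cong) (auto simp: algebra_simps)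
    moreover have "\<dots> = (LINT z|lborel. U z * (\<eta> (fst z) * \<xi> (snd z))) - (LINT z|lborel. m / L * (U z * \<xi> (snd z)))"
      using i1 i2 by (intro Bochner_Integration.integral_diff) auto
    ultimately have "(LINT z|lborel. U z * (\<eta> (fst z) * \<xi> (snd z)))
      = (LINT z|lborel. m / L * (U z * \<xi> (snd z))) - (LINT z|lborel. H z * (a (fst z) * \<xi> (snd z)))" by simp
    also have "\<dots> = (LINT z|lborel. m / L * (U z * \<xi> (snd z)) - H z * (a (fst z) * \<xi> (snd z)))"
      using i2 i3 by (intro Bochner_Integration.integral_diff[symmetric]) auto
    also have "\<dots> \<le> (LINT z|lborel. m * ((\<bar>U z\<bar> / L + \<bar>H z\<bar>) * \<xi> (snd z)))"
    proof (rule integral_mono)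
      fix z
      have "m / L * (U z * \<xi> (snd z)) \<le> m / L * (\<bar>U z\<bar> * \<xi> (snd z))"
        using \<open>0 \<le> m\<close> L \<xi>(3) by (intro mult_left_mono mult_right_mono) auto
      moreover have "- (H z * (a (fst z) * \<xi> (snd z))) \<le> m * (\<bar>H z\<bar> * \<xi> (snd z))"
      proof (cases "H z = 0")
        case False
        then have "\<bar>a (fst z)\<bar> \<le> m" using H(2) box_fst a(4) by blast
        then have "\<bar>H z * a (fst z)\<bar> * \<xi> (snd z) \<le> \<bar>H z\<bar> * m * \<xi> (snd z)"
          using \<xi>(3) by (intro mult_right_mono) (auto simp: abs_mult mult_left_mono)
        moreover have "- (H z * a (fst z)) * \<xi> (snd z) \<le> \<bar>H z * a (fst z)\<bar> * \<xi> (snd z)"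
          using \<xi>(3) by (intro mult_right_mono) auto
        ultimately show ?thesis by (simp add: algebra_simps)
      qed simp
      ultimately show "m / L * (U z * \<xi> (snd z)) - H z * (a (fst z) * \<xi> (snd z)) \<le> m * ((\<bar>U z\<bar> / L + \<bar>H z\<bar>) * \<xi> (snd z))"
        by (simp add: algebra_simps)
    qed (use i2 i3 i4 in auto)
    also have "\<dots> = m * (LINT y|lborel. f y * \<xi> y)"
      using f(4)[of \<xi> 1] \<xi> smooth1_continuous by (simp add: L_def)
    also have "\<dots> = (LINT x|lborel. indicator {fst p<..<fst q} x * \<eta> x) * (LINT y|lborel. f y * \<xi> y)"
      by (simp add: m)
    also have "\<dots> = (LINT z|lborel. (indicator {fst p<..<fst q} (fst z) * \<eta> (fst z)) * (f (snd z) * \<xi> (snd z)))"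
      using \<eta> \<xi> pq by (intro integrable_tensor_product(2)[symmetric] integrable_mult_bounded[where C = 1] f(1)) (auto intro!: integrable_real_indicator)
    also have "\<dots> = (LINT z|lborel. (indicator {fst p<..<fst q} (fst z) * f (snd z)) * (\<eta> (fst z) * \<xi> (snd z)))"
      by (simp add: mult_ac)
    finally show ?thesis
      unfolding g_def left_diff_distrib using i1 i5 by (subst Bochner_Integration.integral_diff) auto
  qed
  have "AE z in lborel. 0 \<le> g z"
  proof (rule AE_nonneg_if_box_integrals_nonneg[OF g _ g0])
    fix a b :: "real \<times> real"
    \<comment> \<open>The function vanishes outside the rectangle, so only the part of the box inside it matters.\<close>
    define a' where "a' = (max (fst a) (fst p), max (snd a) (snd p))"
    define b' where "b' = (min (fst b) (fst q), min (snd b) (snd q))"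
    have ind: "indicator (box a b) z * g z = indicator (box a' b') z * g z" for z
      using g0[of z] unfolding indicator_box_prod
      using indicator_box_prod[of p q z] by (auto simp: a'_def b'_def split: split_indicator split_indicator_asm)
    show "(LINT z:box a b|lborel. g z) \<ge> 0"
    proof (cases "fst a' < fst b' \<and> snd a' < snd b'")
      case False
      then have z: "indicator (box a b) z * g z = 0" for z
        unfolding ind unfolding indicator_box_prod by (auto split: split_indicator)
      show ?thesis unfolding set_lebesgue_integral_def real_scaleR_def z by simp
    next
      case True
      obtain \<eta> where \<eta>: "\<And>n. smooth1 (\<eta> n)" "\<And>n x. \<eta> n (x + (fst q - fst p)) = \<eta> n x"
        "\<And>n x. 0 \<le> \<eta> n x" "\<And>n x. \<eta> n x \<le> 1"
        "\<And>x. fst p < x \<Longrightarrow> x < fst q \<Longrightarrow> x \<noteq> fst a' \<Longrightarrow> x \<noteq> fst b' \<Longrightarrow> (\<lambda>n. \<eta> n x) \<longlonglongrightarrow> indicator {fst a'<..<fst b'} x"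
        by (rule periodic_interval_indicator_approx[of "fst p" "fst a'" "fst b'" "fst q"])
          (use True in \<open>auto simp: a'_def b'_def\<close>)
      obtain \<xi> where \<xi>: "\<And>n. smooth1 (\<xi> n)" "\<And>n x. \<xi> n (x + (snd q - snd p)) = \<xi> n x"
        "\<And>n x. 0 \<le> \<xi> n x" "\<And>n x. \<xi> n x \<le> 1"
        "\<And>x. snd p < x \<Longrightarrow> x < snd q \<Longrightarrow> x \<noteq> snd a' \<Longrightarrow> x \<noteq> snd b' \<Longrightarrow> (\<lambda>n. \<xi> n x) \<longlonglongrightarrow> indicator {snd a'<..<snd b'} x"
        by (rule periodic_interval_indicator_approx[of "snd p" "snd a'" "snd b'" "snd q"])
          (use True in \<open>auto simp: a'_def b'_def\<close>)
      have [measurable]: "\<eta> n \<in> borel_measurable borel" "\<xi> n \<in> borel_measurable borel" for n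
        using \<eta>(1) \<xi>(1) smooth1_continuous by (auto intro!: borel_measurable_continuous_onI)
      have [measurable]: "g \<in> borel_measurable borel" using g by auto
      have "(\<lambda>n. LINT z|lborel. g z * (\<eta> n (fst z) * \<xi> n (snd z))) \<longlonglongrightarrow> (LINT z|lborel. indicator (box a' b') z * g z)"
      proof (rule integral_dominated_convergence[where w = "\<lambda>z. \<bar>g z\<bar>"])
        have hyp: "AE z in lborel. k \<bullet> z \<noteq> c" if "k \<noteq> 0" for k :: "real \<times> real" and c :: real
        proof -
          have "{z. k \<bullet> z = c} \<in> null_sets lebesgue"
            using negligible_hyperplane[of k c] that by (simp add: negligible_iff_null_sets)
          then have "{z. k \<bullet> z = c} \<in> null_sets lborel"
            by (metis borel_closed closed_hyperplane null_sets_completion_iff sets_lborel)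
          then show ?thesis by (auto dest: AE_not_in)
        qed
        have "AE z in lborel. fst (z :: real \<times> real) \<noteq> c" "AE z in lborel. snd (z :: real \<times> real) \<noteq> c" for c :: real
          using hyp[of "(1, 0)" c] hyp[of "(0, 1)" c] by (simp_all add: inner_prod_def zero_prod_def)
        then have "AE z in lborel. fst z \<noteq> fst a' \<and> fst z \<noteq> fst b' \<and> snd z \<noteq> snd a' \<and> snd z \<noteq> snd b'"
          by (intro AE_conjI)
        then show "AE z in lborel. (\<lambda>n. g z * (\<eta> n (fst z) * \<xi> n (snd z))) \<longlonglongrightarrow> indicator (box a' b') z * g z"
        proof eventually_elim
          case (elim z)
          show ?case
          proof (cases "z \<in> box p q")
            case True
            then have "fst p < fst z \<and> fst z < fst q \<and> snd p < snd z \<and> snd z < snd q"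
              using indicator_box_prod[of p q z] by (auto split: split_indicator_asm)
            then have "(\<lambda>n. g z * (\<eta> n (fst z) * \<xi> n (snd z))) \<longlonglongrightarrow>
              g z * (indicator {fst a'<..<fst b'} (fst z) * indicator {snd a'<..<snd b'} (snd z))"
              using elim by (intro tendsto_mult tendsto_const \<eta>(5) \<xi>(5)) auto
            then show ?thesis unfolding indicator_box_prod by (simp add: mult.commute)
          qed (simp add: g0)
        qed
        show "AE z in lborel. norm (g z * (\<eta> n (fst z) * \<xi> n (snd z))) \<le> \<bar>g z\<bar>" for n
          using \<eta>(3,4) \<xi>(3,4) by (auto simp: abs_mult intro!: mult_left_le mult_le_one)
      qed (use g in auto)
      then have "0 \<le> (LINT z|lborel. indicator (box a' b') z * g z)"
        by (rule LIMSEQ_le_const) (use smooth_test \<eta> \<xi> in auto)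
      then show ?thesis by (simp add: set_lebesgue_integral_def ind)
    qed
  qed
  then show ?thesis
  proof eventually_elim
    case (elim z)
    then show ?case using f(2)[of "snd z"] by (auto simp: g_def split: split_indicator_asm)
  qed
qed

text \<open>
  The one-sided bound applies to \<open>U\<close> and to \<open>- U\<close>, and the envelope inherits square integrability from
  \<open>\<bar>U\<bar> / L + \<bar>H\<bar>\<close>.
\<close>

lemma weak_derivative_L2_envelope:
  fixes U H :: "real \<times> real \<Rightarrow> real" and p q :: "real \<times> real"
  assumes pq: "fst p < fst q" "snd p < snd q"
    and U: "U \<in> borel_measurable lborel" "integrable lborel (\<lambda>z. (U z)\<^sup>2)" "\<And>z. z \<notin> box p q \<Longrightarrow> U z = 0"
    and H: "H \<in> borel_measurable lborel" "integrable lborel (\<lambda>z. (H z)\<^sup>2)" "\<And>z. z \<notin> box p q \<Longrightarrow> H z = 0"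
    and weak: "\<And>a a' b. smooth1 a \<Longrightarrow> (\<And>x. (a has_real_derivative a' x) (at x)) \<Longrightarrow>
       (\<And>x. a (x + (fst q - fst p)) = a x) \<Longrightarrow> smooth1 b \<Longrightarrow> (\<And>y. b (y + (snd q - snd p)) = b y) \<Longrightarrow>
       (LINT z|lborel. U z * (a' (fst z) * b (snd z))) = - (LINT z|lborel. H z * (a (fst z) * b (snd z)))"
  obtains f where "integrable lborel (\<lambda>y. (f y)\<^sup>2)" "AE z in lborel. \<bar>U z\<bar> \<le> f (snd z)"
proof
  define h where "h z = \<bar>U z\<bar> / (fst q - fst p) + \<bar>H z\<bar>" for z
  have Ui: "integrable lborel U" and Hi: "integrable lborel H"
    using integrable_of_square_integrable[OF U] integrable_of_square_integrable[OF H] by auto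
  have "h \<in> borel_measurable lborel" using U H unfolding h_def by measurable
  moreover have "integrable lborel (\<lambda>z. (h z)\<^sup>2)"
  proof -
    have "integrable lborel (\<lambda>z. \<bar>U z\<bar> * \<bar>H z\<bar>)"
      using U H by (intro integrable_mult_of_square_integrable) auto
    then have "integrable lborel (\<lambda>z. (U z)\<^sup>2 / (fst q - fst p)\<^sup>2 + (H z)\<^sup>2 + 2 / (fst q - fst p) * (\<bar>U z\<bar> * \<bar>H z\<bar>))"
      using U H by auto
    then show ?thesis by (simp add: h_def power2_sum power_divide mult.assoc)
  qed
  moreover have "h z = 0" if "z \<notin> box p q" for z using that U(3) H(3) by (simp add: h_def)
  ultimately show "integrable lborel (\<lambda>y. (LINT x|lborel. h (x, y))\<^sup>2)"
    using pq(1) by (intro slice_integral_square_integrable) auto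
  have "AE z in lborel. U z \<le> (LINT x|lborel. h (x, snd z))"
    unfolding h_def by (rule weak_derivative_slice_bound[OF pq Ui U(3) Hi H(3) weak])
  moreover have "AE z in lborel. - U z \<le> (LINT x|lborel. \<bar>- U (x, snd z)\<bar> / (fst q - fst p) + \<bar>- H (x, snd z)\<bar>)"
    using weak Ui Hi U(3) H(3) by (intro weak_derivative_slice_bound[OF pq, of "\<lambda>z. - U z" "\<lambda>z. - H z"]) auto
  ultimately show "AE z in lborel. \<bar>U z\<bar> \<le> (LINT x|lborel. h (x, snd z))"
    by eventually_elim (auto simp: h_def)
qed

text \<open>
  Interchanging the coordinates preserves Lebesgue measure. This lets statements about the first partial
  derivative be used for the second one.
\<close>

lemma lborel_swap:
  fixes f :: "real \<times> real \<Rightarrow> real"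
  shows "integrable lborel f \<Longrightarrow> integrable lborel (\<lambda>z. f (prod.swap z))"
    and "f \<in> borel_measurable lborel \<Longrightarrow> (LINT z|lborel. f (prod.swap z)) = (LINT z|lborel. f z)"
    and "(AE z in lborel. P (prod.swap z)) \<Longrightarrow> (AE z in lborel. P (z :: real \<times> real))"
proof -
  have "(lborel \<Otimes>\<^sub>M lborel :: (real \<times> real) measure) =
      distr (lborel \<Otimes>\<^sub>M lborel) (lborel \<Otimes>\<^sub>M lborel) (\<lambda>(x, y). (y, x))"
    by (rule lborel_pair.distr_pair_swap)
  moreover have swap: "(\<lambda>(x, y). (y, x)) = (prod.swap :: real \<times> real \<Rightarrow> _)" by auto
  ultimately have d: "distr lborel lborel prod.swap = (lborel :: (real \<times> real) measure)"
    by (simp add: lborel_prod)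
  have m: "prod.swap \<in> lborel \<rightarrow>\<^sub>M (lborel :: (real \<times> real) measure)"
    unfolding lborel_prod[symmetric] swap[symmetric] by (rule measurable_pair_swap')
  show "integrable lborel f \<Longrightarrow> integrable lborel (\<lambda>z. f (prod.swap z))"
    using integrable_distr[OF m, of f] by (simp add: d)
  show "f \<in> borel_measurable lborel \<Longrightarrow> (LINT z|lborel. f (prod.swap z)) = (LINT z|lborel. f z)"
    using integral_distr[OF m, of f] by (simp add: d)
  assume "AE z in lborel. P (prod.swap z)"
  then have "AE z in distr lborel lborel prod.swap. P (prod.swap z)" unfolding d .
  from AE_distrD[OF m this] show "AE z in lborel. P z" by simp
qed

text \<open>
  Ladyzhenskaya's argument: \<open>\<bar>u\<bar>\<close> has an \<open>L\<^sup>2\<close> envelope \<open>f\<close> depending only on the second coordinate and, by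
  interchanging the coordinates, an \<open>L\<^sup>2\<close> envelope \<open>g\<close> depending only on the first; then \<open>u\<^sup>4\<close> is dominated by
  the product of \<open>f\<^sup>2\<close> and \<open>g\<^sup>2\<close>, which is integrable by Tonelli's theorem.
\<close>

lemma H1_periodic_L4:
  assumes pq: "fst p < fst q" "snd p < snd q" and u: "u \<in> H1_periodic p q"
  shows "set_integrable lborel (box p q) (\<lambda>x. (u x) ^ 4)"
proof -
  obtain G where G: "has_weak_gradient p q u G" using u by (auto simp: H1_periodic_def)
  define U where "U z = indicator (box p q) z * u z" for z
  define H1 where "H1 z = indicator (box p q) z * fst (G z)" for z
  define H2 where "H2 z = indicator (box p q) z * snd (G z)" for z
  have GH: "indicator (box p q) z *\<^sub>R G z = (H1 z, H2 z)" for z by (simp add: H1_def H2_def prod_eq_iff)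
  have sup: "U z = 0" "H1 z = 0" "H2 z = 0" if "z \<notin> box p q" for z using that by (simp_all add: U_def H1_def H2_def)
  have Um: "U \<in> borel_measurable lborel"
    using G by (simp add: has_weak_gradient_def square_integrable_def set_borel_measurable_def U_def[abs_def])
  have U2: "integrable lborel (\<lambda>z. (U z)\<^sup>2)"
  proof -
    have "integrable lborel (\<lambda>z. indicator (box p q) z * (norm (u z))\<^sup>2)"
      using G by (simp add: has_weak_gradient_def square_integrable_def set_integrable_def)
    moreover have "indicator (box p q) z * (norm (u z))\<^sup>2 = (U z)\<^sup>2" for z
      by (auto simp: U_def split: split_indicator)
    ultimately show ?thesis by simp
  qed
  have Gm: "(\<lambda>z. (H1 z, H2 z)) \<in> borel_measurable lborel"
    using G by (simp add: has_weak_gradient_def square_integrable_def set_borel_measurable_def GH)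
  have Hm: "H1 \<in> borel_measurable lborel" "H2 \<in> borel_measurable lborel"
    using measurable_compose[OF Gm borel_measurable_continuous_onI[OF continuous_on_fst[OF continuous_on_id]]]
      measurable_compose[OF Gm borel_measurable_continuous_onI[OF continuous_on_snd[OF continuous_on_id]]] by simp_all
  have G2: "integrable lborel (\<lambda>z. (H1 z)\<^sup>2 + (H2 z)\<^sup>2)"
  proof -
    have "integrable lborel (\<lambda>z. indicator (box p q) z * (norm (G z))\<^sup>2)"
      using G by (auto simp: has_weak_gradient_def square_integrable_def set_integrable_def)
    moreover have "indicator (box p q) z * (norm (G z))\<^sup>2 = (H1 z)\<^sup>2 + (H2 z)\<^sup>2" for z
      by (auto simp: H1_def H2_def norm_prod_def split: split_indicator)
    ultimately show ?thesis by simp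
  qed
  have H2i: "integrable lborel (\<lambda>z. (H1 z)\<^sup>2)" "integrable lborel (\<lambda>z. (H2 z)\<^sup>2)"
    by (rule Bochner_Integration.integrable_bound[OF G2]; use Hm in auto)+
  have Ui: "integrable lborel U" by (rule integrable_of_square_integrable[OF Um U2 sup(1)])
  have Hi: "integrable lborel H1" "integrable lborel H2"
    using integrable_of_square_integrable[OF Hm(1) H2i(1) sup(2)] integrable_of_square_integrable[OF Hm(2) H2i(2) sup(3)] by auto
  have weakG: "(LINT x:box p q|lborel. u x *\<^sub>R D x) = - (LINT x:box p q|lborel. \<psi> x *\<^sub>R G x)"
    if "smooth_periodic p q \<psi>" "\<And>x. GDERIV \<psi> x :> D x" for \<psi> D
    using G that by (auto simp: has_weak_gradient_def)
  have weak: "(LINT z|lborel. U z * (a' (fst z) * b (snd z))) = - (LINT z|lborel. H1 z * (a (fst z) * b (snd z)))"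
    "(LINT z|lborel. U z * (a (fst z) * b' (snd z))) = - (LINT z|lborel. H2 z * (a (fst z) * b (snd z)))"
    if a: "smooth1 a" "\<And>x. (a has_real_derivative a' x) (at x)" "\<And>x. a (x + (fst q - fst p)) = a x"
      and b: "smooth1 b" "\<And>x. (b has_real_derivative b' x) (at x)" "\<And>y. b (y + (snd q - snd p)) = b y"
    for a a' b b'
  proof -
    have ab': "smooth1 a'" "smooth1 b'" using a b smooth1_D by blast+
    have cont: "continuous_on UNIV (\<lambda>z::real \<times> real. f (fst z) * g (snd z))" if "smooth1 f" "smooth1 g" for f g
      using C_k_prod[of 0 f g] smooth1_continuous[OF that(1)] smooth1_continuous[OF that(2)] by simp
    define D where "D z = (a' (fst z) * b (snd z), a (fst z) * b' (snd z))" for z :: "real \<times> real"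
    have "(LINT z:box p q|lborel. u z *\<^sub>R D z) = - (LINT z:box p q|lborel. (a (fst z) * b (snd z)) *\<^sub>R G z)"
      unfolding D_def
      by (rule weakG[OF smooth_periodic_prod[OF a(1,3) b(1,3)] GDERIV_prod[OF a(2) b(2)]])
    moreover have "(LINT z:box p q|lborel. u z *\<^sub>R D z) = (LINT z|lborel. (U z * (a' (fst z) * b (snd z)), U z * (a (fst z) * b' (snd z))))"
      by (simp add: set_lebesgue_integral_def D_def U_def mult.assoc)
    moreover have "\<dots> = (LINT z|lborel. U z * (a' (fst z) * b (snd z)), LINT z|lborel. U z * (a (fst z) * b' (snd z)))"
      by (intro integral_Pair integrable_mult_continuous[OF Ui sup(1)] cont a b ab')
    moreover have "(LINT z:box p q|lborel. (a (fst z) * b (snd z)) *\<^sub>R G z) =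
        (LINT z|lborel. (H1 z * (a (fst z) * b (snd z)), H2 z * (a (fst z) * b (snd z))))"
      unfolding set_lebesgue_integral_def scaleR_left_commute[of "indicator _ _"] GH
      by (simp add: mult_ac)
    moreover have "\<dots> = (LINT z|lborel. H1 z * (a (fst z) * b (snd z)), LINT z|lborel. H2 z * (a (fst z) * b (snd z)))"
      by (intro integral_Pair integrable_mult_continuous[OF Hi(1) sup(2)] integrable_mult_continuous[OF Hi(2) sup(3)] cont a b)
    ultimately show "(LINT z|lborel. U z * (a' (fst z) * b (snd z))) = - (LINT z|lborel. H1 z * (a (fst z) * b (snd z)))"
      "(LINT z|lborel. U z * (a (fst z) * b' (snd z))) = - (LINT z|lborel. H2 z * (a (fst z) * b (snd z)))"
      by simp_all
  qed
  have ex_deriv: "\<exists>b'. \<forall>x. (b has_real_derivative b' x) (at x)" if "smooth1 b" for b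
  proof -
    have "diff_k (Suc 0) b" using that by (simp only: smooth1_def)
    then show ?thesis by auto
  qed
  obtain f where f: "integrable lborel (\<lambda>y. (f y)\<^sup>2)" "AE z in lborel. \<bar>U z\<bar> \<le> f (snd z)"
  proof (rule weak_derivative_L2_envelope[OF pq Um U2 sup(1) Hm(1) H2i(1) sup(2)])
    fix a a' b assume "smooth1 a" "\<And>x. (a has_real_derivative a' x) (at x)" "\<And>x. a (x + (fst q - fst p)) = a x"
      "smooth1 b" "\<And>y. b (y + (snd q - snd p)) = b y"
    with weak(1) ex_deriv[of b] show "(LINT z|lborel. U z * (a' (fst z) * b (snd z))) = - (LINT z|lborel. H1 z * (a (fst z) * b (snd z)))"
      by blast
  qed auto
  have swap_box: "prod.swap z \<notin> box p q" if "z \<notin> box (prod.swap p) (prod.swap q)" for z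
    using that by (cases z, cases p, cases q) (auto simp: box_def Basis_prod_def)
  \<comment> \<open>The same envelope for the other coordinate: interchange the coordinates of \<open>U\<close> and use the second weak partial derivative.\<close>
  obtain g where g: "integrable lborel (\<lambda>y. (g y)\<^sup>2)" "AE z in lborel. \<bar>U (prod.swap z)\<bar> \<le> g (snd z)"
  proof (rule weak_derivative_L2_envelope[of "prod.swap p" "prod.swap q" "\<lambda>z. U (prod.swap z)" "\<lambda>z. H2 (prod.swap z)"])
    show "fst (prod.swap p) < fst (prod.swap q)" "snd (prod.swap p) < snd (prod.swap q)" using pq by auto
    show "(\<lambda>z. U (prod.swap z)) \<in> borel_measurable lborel" "(\<lambda>z. H2 (prod.swap z)) \<in> borel_measurable lborel"
      using lborel_swap(1)[OF Ui] lborel_swap(1)[OF Hi(2)] by (auto dest: borel_measurable_integrable)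
    show "integrable lborel (\<lambda>z. (U (prod.swap z))\<^sup>2)" "integrable lborel (\<lambda>z. (H2 (prod.swap z))\<^sup>2)"
      using lborel_swap(1)[OF U2] lborel_swap(1)[OF H2i(2)] by auto
    show "U (prod.swap z) = 0" "H2 (prod.swap z) = 0" if "z \<notin> box (prod.swap p) (prod.swap q)" for z
      using swap_box[OF that] sup by auto
    fix a a' b assume a: "smooth1 a" "\<And>x. (a has_real_derivative a' x) (at x)"
      "\<And>x. a (x + (fst (prod.swap q) - fst (prod.swap p))) = a x"
      and b: "smooth1 b" "\<And>y. b (y + (snd (prod.swap q) - snd (prod.swap p))) = b y"
    obtain b' where b': "\<And>x. (b has_real_derivative b' x) (at x)" using ex_deriv[OF b(1)] by blast
    have cont: "continuous_on UNIV (\<lambda>z::real \<times> real. b (fst z) * c (snd z))" if "smooth1 c" for c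
      using C_k_prod[of 0 b c] smooth1_continuous[OF b(1)] smooth1_continuous[OF that] by simp
    have sa': "smooth1 a'" using a smooth1_D by blast
    have "(LINT z|lborel. U z * (b (fst z) * a' (snd z))) = - (LINT z|lborel. H2 z * (b (fst z) * a (snd z)))"
      by (rule weak(2)[OF b(1) b' _ a(1,2)]) (use a b in auto)
    then show "(LINT z|lborel. U (prod.swap z) * (a' (fst z) * b (snd z))) = - (LINT z|lborel. H2 (prod.swap z) * (a (fst z) * b (snd z)))"
      using lborel_swap(2)[OF borel_measurable_integrable[OF integrable_mult_continuous[OF Ui sup(1) cont[OF sa']]]]
        lborel_swap(2)[OF borel_measurable_integrable[OF integrable_mult_continuous[OF Hi(2) sup(3) cont[OF a(1)]]]]
      by (simp add: mult.commute)
  qed auto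
  have g': "AE z in lborel. \<bar>U z\<bar> \<le> g (fst z)"
    by (rule lborel_swap(3)) (use g(2) in simp)
  have "integrable lborel (\<lambda>z. (U z) ^ 4)"
  proof (rule Bochner_Integration.integrable_bound[OF integrable_tensor_product(1)[OF g(1) f(1)]])
    show "AE z in lborel. norm ((U z) ^ 4) \<le> norm ((g (fst z))\<^sup>2 * (f (snd z))\<^sup>2)"
      using g' f(2)
    proof eventually_elim
      case (elim z)
      have "(U z) ^ 4 = \<bar>U z\<bar>\<^sup>2 * \<bar>U z\<bar>\<^sup>2" by (simp flip: power_add)
      also have "\<dots> \<le> (g (fst z))\<^sup>2 * (f (snd z))\<^sup>2"
        using elim by (intro mult_mono power_mono) auto
      finally show ?case by simp
    qed
  qed (use Um in measurable)
  moreover have "indicator (box p q) z *\<^sub>R (u z) ^ 4 = (U z) ^ 4" for z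
    by (simp add: U_def split: split_indicator)
  ultimately show ?thesis by (simp add: set_integrable_def)
qed

section \<open>Orthogonal kernels of triangular arrays\<close>

text \<open>
  By induction from \<open>k = n - 1\<close> downwards. Subtracting a multiple of the orthogonality relation for column
  \<open>k + 1\<close> from that for column \<open>k\<close>, with the factor chosen so that the terms of row \<open>n\<close> cancel, leaves besides
  the diagonal term only entries \<open>\<Theta> n j\<close> whose sign is known by induction, and their coefficients are non-positive because the
  ratio of the two columns increases down the rows.
\<close>

lemma orthogonal_kernel_nonpos:
  fixes A \<Theta> :: "nat \<Rightarrow> nat \<Rightarrow> real"
  assumes pos: "\<And>j k. 1 \<le> k \<Longrightarrow> k \<le> j \<Longrightarrow> j \<le> n \<Longrightarrow> A j k > 0"
    and cross: "\<And>j k. 1 \<le> k \<Longrightarrow> k < j \<Longrightarrow> j < n \<Longrightarrow> A j k * A n (Suc k) \<le> A n k * A j (Suc k)"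
    and orth: "\<And>k. 1 \<le> k \<Longrightarrow> k < n \<Longrightarrow> (\<Sum>j=k..n. \<Theta> n j * A j k) = 0"
    and diag: "\<Theta> n n > 0"
    and k: "1 \<le> k" "k < n"
  shows "\<Theta> n k \<le> 0"
  using k
proof (induction "n - k" arbitrary: k rule: less_induct)
  case less
  have "(\<Sum>j=Suc k..n. \<Theta> n j * A j k) \<ge> 0"
  proof (cases "Suc k = n")
    case True
    then show ?thesis using diag pos[of k n] less.prems by simp
  next
    case False
    define r where "r = A n k / A n (Suc k)"
    have An: "A n (Suc k) > 0" using pos less.prems by auto
    have "0 \<le> (\<Sum>j=Suc k..n. \<Theta> n j * (A j k - r * A j (Suc k)))"
    proof (rule sum_nonneg)
      fix j assume j: "j \<in> {Suc k..n}"
      show "0 \<le> \<Theta> n j * (A j k - r * A j (Suc k))"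
      proof (cases "j = n")
        case True
        then show ?thesis using An by (simp add: r_def)
      next
        case False
        then have "\<Theta> n j \<le> 0" using j less by (intro less.hyps) auto
        moreover have "A j k - r * A j (Suc k) \<le> 0"
          using cross[of k j] j False less.prems An by (simp add: r_def field_simps)
        ultimately show ?thesis by (rule mult_nonpos_nonpos)
      qed
    qed
    also have "\<dots> = (\<Sum>j=Suc k..n. \<Theta> n j * A j k) - r * (\<Sum>j=Suc k..n. \<Theta> n j * A j (Suc k))"
      by (simp add: sum_distrib_left sum_subtractf algebra_simps)
    also have "(\<Sum>j=Suc k..n. \<Theta> n j * A j (Suc k)) = 0"
      using orth[of "Suc k"] False less.prems by simp
    finally show ?thesis by simp
  qed
  moreover have "(\<Sum>j=k..n. \<Theta> n j * A j k) = \<Theta> n k * A k k + (\<Sum>j=Suc k..n. \<Theta> n j * A j k)"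
    using less.prems by (simp add: sum.atLeast_Suc_atMost)
  ultimately have "\<Theta> n k * A k k \<le> 0" using orth[of k] less.prems by linarith
  then show ?case using pos[of k k] less.prems by (simp add: mult_le_0_iff)
qed

text \<open>
  In the orthogonality relation with the first column, replacing each entry of that column by its last
  and smallest one can only increase the sum, as only the last term has a positive weight.
\<close>

lemma orthogonal_kernel_sum_nonneg:
  fixes A \<Theta> :: "nat \<Rightarrow> nat \<Rightarrow> real"
  assumes pos: "A n 1 > 0"
    and dec: "\<And>j. 1 \<le> j \<Longrightarrow> j \<le> n \<Longrightarrow> A n 1 \<le> A j 1"
    and orth: "1 < n \<Longrightarrow> (\<Sum>j=1..n. \<Theta> n j * A j 1) = 0"
    and diag: "\<Theta> n n > 0" and nonpos: "\<And>k. 1 \<le> k \<Longrightarrow> k < n \<Longrightarrow> \<Theta> n k \<le> 0"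
    and "1 \<le> n"
  shows "(\<Sum>j=1..n. \<Theta> n j) \<ge> 0"
proof (cases "n = 1")
  case False
  then have "0 = (\<Sum>j=1..n. \<Theta> n j * A j 1)" using orth \<open>1 \<le> n\<close> by simp
  also have "\<dots> \<le> (\<Sum>j=1..n. \<Theta> n j * A n 1)"
  proof (rule sum_mono)
    fix j assume "j \<in> {1..n}"
    then show "\<Theta> n j * A j 1 \<le> \<Theta> n j * A n 1"
      using nonpos[of j] dec[of j] by (cases "j = n") (auto intro: mult_left_mono_neg)
  qed
  finally show ?thesis using pos by (simp add: sum_distrib_right[symmetric] zero_le_mult_iff)
qed (use diag in simp)

text \<open>
  A left inverse of the triangular array recovers \<open>X n\<close> from the convolutions \<open>Y\<close>, after exchanging the
  order of summation.
\<close>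

lemma orthogonal_kernel_inverts:
  fixes A :: "nat \<Rightarrow> nat \<Rightarrow> real" and \<Theta> X Y :: "nat \<Rightarrow> real"
  assumes orth: "\<And>k. 1 \<le> k \<Longrightarrow> k \<le> n \<Longrightarrow> (\<Sum>j=k..n. \<Theta> j * A j k) = (if k = n then 1 else 0)"
    and conv: "\<And>j. 1 \<le> j \<Longrightarrow> j \<le> n \<Longrightarrow> (\<Sum>k=1..j. A j k * X k) = Y j" and n: "1 \<le> n"
  shows "X n = (\<Sum>j=1..n. \<Theta> j * Y j)"
proof -
  have "(\<Sum>j=1..n. \<Theta> j * Y j) = (\<Sum>j\<in>{1..n}. \<Sum>k\<in>{k. k \<in> {1..n} \<and> k \<le> j}. \<Theta> j * (A j k * X k))"
  proof (rule sum.cong)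
    fix j assume j: "j \<in> {1..n}"
    then have "{k. k \<in> {1..n} \<and> k \<le> j} = {1..j}" by auto
    then show "\<Theta> j * Y j = (\<Sum>k\<in>{k. k \<in> {1..n} \<and> k \<le> j}. \<Theta> j * (A j k * X k))"
      using conv[of j] j by (simp add: sum_distrib_left[symmetric])
  qed simp
  also have "\<dots> = (\<Sum>k\<in>{1..n}. \<Sum>j\<in>{j. j \<in> {1..n} \<and> k \<le> j}. \<Theta> j * (A j k * X k))"
    by (rule sum.swap_restrict) auto
  also have "\<dots> = (\<Sum>k=1..n. (if k = n then X k else 0))"
  proof (rule sum.cong)
    fix k assume k: "k \<in> {1..n}"
    then have "{j. j \<in> {1..n} \<and> k \<le> j} = {k..n}" by auto
    then have "(\<Sum>j\<in>{j. j \<in> {1..n} \<and> k \<le> j}. \<Theta> j * (A j k * X k)) = (\<Sum>j=k..n. \<Theta> j * A j k) * X k"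
      by (simp add: sum_distrib_right mult.assoc)
    then show "(\<Sum>j\<in>{j. j \<in> {1..n} \<and> k \<le> j}. \<Theta> j * (A j k * X k)) = (if k = n then X k else 0)"
      using orth[of k] k by simp
  qed simp
  also have "\<dots> = X n" using n by simp
  finally show ?thesis by simp
qed

section \<open>The L1 kernels and their orthogonal kernels\<close>

text \<open>
  The integrand is singular at \<open>s = c\<close> when \<open>b = c\<close>, but its primitive is continuous up to there.
\<close>

lemma omega_has_integral:
  fixes \<alpha> :: real
  assumes "0 < \<alpha>" "\<alpha> < 1" "a \<le> b" "b \<le> c"
  shows "((\<lambda>s. omega (1 - \<alpha>) (c - s)) has_integral
          ((c - a) powr (1 - \<alpha>) - (c - b) powr (1 - \<alpha>)) / Gamma (2 - \<alpha>)) {a..b}"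
proof -
  define W where "W s = - ((c - s) powr (1 - \<alpha>)) / Gamma (2 - \<alpha>)" for s
  have G: "Gamma (2 - \<alpha>) = (1 - \<alpha>) * Gamma (1 - \<alpha>)"
    using Gamma_plus1[of "1 - \<alpha>"] nonpos_Ints_nonpos[of "1 - \<alpha>"] assms by force
  have Gp: "Gamma (1 - \<alpha>) > 0" "Gamma (1 - \<alpha>) \<noteq> 0"
    using Gamma_real_pos[of "1 - \<alpha>"] assms by fastforce+
  have "((\<lambda>s. omega (1 - \<alpha>) (c - s)) has_integral (W b - W a)) {a..b}"
  proof (rule fundamental_theorem_of_calculus_interior)
    show "continuous_on {a..b} W"
      unfolding W_def using assms Gp by (intro continuous_on_divide continuous_on_minus continuous_on_powr' continuous_intros) (auto simp: G)
    fix s assume s: "s \<in> {a<..<b}"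
    have "((\<lambda>s. - ((c - s) powr (1 - \<alpha>))) has_real_derivative (1 - \<alpha>) * (c - s) powr (- \<alpha>)) (at s)"
      using s assms by (auto intro!: derivative_eq_intros)
    from DERIV_cdivide[OF this, of "Gamma (2 - \<alpha>)"]
    have "(W has_real_derivative omega (1 - \<alpha>) (c - s)) (at s)"
      using assms by (simp add: W_def[abs_def] omega_def G)
    then show "(W has_vector_derivative omega (1 - \<alpha>) (c - s)) (at s)"
      by (simp add: has_real_derivative_iff_has_vector_derivative)
  qed (use assms in auto)
  then show ?thesis by (simp add: W_def field_simps diff_divide_distrib)
qed

text \<open>
  Logarithmic convexity of \<open>\<omega>\<^sub>1\<^sub>-\<^sub>\<alpha>\<close>: the quotient of its values at \<open>c - s\<close> and \<open>d - s\<close> increases in \<open>s\<close>, and its value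
  at \<open>s = b\<close> is \<open>R\<close>. Comparing with this single constant on both sides of \<open>b\<close> makes the integrals over the
  two sides comparable one at a time.
\<close>

lemma omega_ratio:
  assumes "0 < \<alpha>" "\<alpha> < 1" "b < c" "c \<le> d"
  defines "R \<equiv> ((d - b) / (c - b)) powr \<alpha>"
  shows omega_ratio_left: "s < b \<Longrightarrow> omega (1 - \<alpha>) (c - s) \<le> R * omega (1 - \<alpha>) (d - s)"
    and omega_ratio_right: "b < s \<Longrightarrow> s < c \<Longrightarrow> R * omega (1 - \<alpha>) (d - s) \<le> omega (1 - \<alpha>) (c - s)"
proof -
  have Gp: "Gamma (1 - \<alpha>) > 0" using assms by (intro Gamma_real_pos) auto
  have *: "omega (1 - \<alpha>) (c - s) = ((d - s) / (c - s)) powr \<alpha> * omega (1 - \<alpha>) (d - s)" if "s < c" for s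
    using that assms(1-4) by (simp add: omega_def powr_divide powr_minus field_simps)
  have pos: "0 \<le> omega (1 - \<alpha>) (d - s)" for s using Gp by (simp add: omega_def)
  have ratio: "(d - r) / (c - r) \<le> (d - s) / (c - s)" if "r \<le> s" "s < c" for r s
    using that assms mult_right_mono[of r s "d - c"] by (simp add: field_simps)
  { assume "s < b"
    then show "omega (1 - \<alpha>) (c - s) \<le> R * omega (1 - \<alpha>) (d - s)"
      unfolding R_def using assms(1-4)
      by (subst *) (auto intro!: mult_right_mono pos powr_mono2 ratio) }
  { assume "b < s" "s < c"
    then show "R * omega (1 - \<alpha>) (d - s) \<le> omega (1 - \<alpha>) (c - s)"
      unfolding R_def using assms(1-4)
      by (subst *) (auto intro!: mult_right_mono pos powr_mono2 ratio) }
qed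

lemma DOC_kernel_diag: "DOC_kernel \<alpha> t n 0 = 1 / L1_kernel \<alpha> t n 0"
  by (simp add: DOC_kernel.simps)

lemma DOC_kernel_orthogonal:
  assumes "1 \<le> k" "k \<le> n" "L1_kernel \<alpha> t k 0 \<noteq> 0"
  shows "(\<Sum>j=k..n. DOC_kernel \<alpha> t n (n - j) * L1_kernel \<alpha> t j (j - k)) = (if k = n then 1 else 0)"
proof (cases "k = n")
  case False
  then have "DOC_kernel \<alpha> t n (n - k) = - (1 / L1_kernel \<alpha> t k 0) *
     (\<Sum>j=k+1..n. DOC_kernel \<alpha> t n (n - j) * L1_kernel \<alpha> t j (j - k))"
    using assms by (subst DOC_kernel.simps) (simp add: Let_def)
  then have "DOC_kernel \<alpha> t n (n - k) * L1_kernel \<alpha> t k 0 =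
     - (\<Sum>j=Suc k..n. DOC_kernel \<alpha> t n (n - j) * L1_kernel \<alpha> t j (j - k))"
    using assms by simp
  then show ?thesis using False assms by (simp add: sum.atLeast_Suc_atMost)
qed (use assms in \<open>simp add: DOC_kernel_diag\<close>)

lemma L1_kernel_eq_integral:
  assumes "1 \<le> k" "k \<le> n"
  shows "L1_kernel \<alpha> t n (n - k) = 1 / (t k - t (k - 1)) * integral {t (k - 1)..t k} (\<lambda>s. omega (1 - \<alpha>) (t n - s))"
  using assms by (simp add: L1_kernel_def Let_def time_step_def)

context
  fixes \<alpha> :: real and t :: "nat \<Rightarrow> real" and N :: nat
  assumes \<alpha>: "0 < \<alpha>" "\<alpha> < 1"
    and step: "\<forall>n\<in>{1..N}. t (n - 1) < t n"
begin

lemma mesh_strict_mono: "i < j \<Longrightarrow> j \<le> N \<Longrightarrow> t i < t j"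
proof (induction j)
  case (Suc j)
  have "t j < t (Suc j)" using step[rule_format, of "Suc j"] Suc.prems by auto
  then show ?case using Suc by (cases "i = j") auto
qed simp

lemma mesh_mono: "i \<le> j \<Longrightarrow> j \<le> N \<Longrightarrow> t i \<le> t j"
  using mesh_strict_mono[of i j] by (cases "i = j") auto

lemma omega_integrable:
  "a \<le> b \<Longrightarrow> b \<le> c \<Longrightarrow> (\<lambda>s. omega (1 - \<alpha>) (c - s)) integrable_on {a..b}"
  using omega_has_integral[OF \<alpha>] by blast

lemma L1_kernel_closed_form:
  assumes "1 \<le> k" "k \<le> n" "n \<le> N"
  shows "L1_kernel \<alpha> t n (n - k) =
    ((t n - t (k - 1)) powr (1 - \<alpha>) - (t n - t k) powr (1 - \<alpha>)) / (Gamma (2 - \<alpha>) * (t k - t (k - 1)))"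
proof -
  have "integral {t (k - 1)..t k} (\<lambda>s. omega (1 - \<alpha>) (t n - s)) =
    ((t n - t (k - 1)) powr (1 - \<alpha>) - (t n - t k) powr (1 - \<alpha>)) / Gamma (2 - \<alpha>)"
    using assms by (intro integral_unique omega_has_integral \<alpha> mesh_mono) auto
  then show ?thesis using assms by (simp add: L1_kernel_eq_integral)
qed

lemma L1_kernel_pos:
  assumes "1 \<le> k" "k \<le> n" "n \<le> N"
  shows "L1_kernel \<alpha> t n (n - k) > 0"
proof -
  have "t (k - 1) < t k" "t k \<le> t n" using mesh_strict_mono[of "k-1" k] mesh_mono[of k n] assms by auto
  then show ?thesis unfolding L1_kernel_closed_form[OF assms] using \<alpha>
    by (intro divide_pos_pos mult_pos_pos Gamma_real_pos) (auto intro!: powr_less_mono2)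
qed

text \<open>
  The value \<open>\<tau>\<^sup>-\<^sup>\<alpha> / \<Gamma>(2 - \<alpha>)\<close> is what turns the restriction on the time steps into a bound on the leading
  orthogonal kernel.
\<close>

lemma L1_kernel_diag:
  assumes "1 \<le> n" "n \<le> N"
  shows "L1_kernel \<alpha> t n 0 = 1 / (Gamma (2 - \<alpha>) * time_step t n powr \<alpha>)"
proof -
  have "0 < time_step t n" using step assms by (simp add: time_step_def)
  moreover have "L1_kernel \<alpha> t n 0 = time_step t n powr (1 - \<alpha>) / (Gamma (2 - \<alpha>) * time_step t n)"
    using L1_kernel_closed_form[of n n] assms by (simp add: time_step_def)
  ultimately show ?thesis by (simp add: powr_diff)
qed

text \<open>
  The ratio of the columns \<open>k\<close> and \<open>k + 1\<close> increases down the rows. The constant \<open>R\<close> is the quotient of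
  the two weights at the common end point \<open>t k\<close> of the two subintervals: it bounds the quotient from above on
  the left one and from below on the right one.
\<close>

lemma L1_kernel_cross:
  assumes "1 \<le> k" "k < j" "j \<le> n" "n \<le> N"
  shows "L1_kernel \<alpha> t j (j - k) * L1_kernel \<alpha> t n (n - Suc k)
    \<le> L1_kernel \<alpha> t n (n - k) * L1_kernel \<alpha> t j (j - Suc k)"
proof -
  define R where "R = ((t n - t k) / (t j - t k)) powr \<alpha>"
  have o: "t (k - 1) < t k" "t k < t (Suc k)" "t (Suc k) \<le> t j" "t j \<le> t n"
    using assms mesh_strict_mono[of "k-1" k] mesh_strict_mono[of k "Suc k"] mesh_mono[of "Suc k" j] mesh_mono[of j n]
    by auto
  have "integral {t (k-1)..t k} (\<lambda>s. omega (1 - \<alpha>) (t j - s)) \<le>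
        integral {t (k-1)..t k} (\<lambda>s. R * omega (1 - \<alpha>) (t n - s))"
    unfolding integral_open_interval_real R_def
    by (rule integral_le) (use o in \<open>auto intro!: omega_ratio_left \<alpha> integrable_on_cmult_left omega_integrable simp: integrable_on_open_interval_real\<close>)
  then have left: "L1_kernel \<alpha> t j (j - k) \<le> R * L1_kernel \<alpha> t n (n - k)"
    using assms o by (simp add: L1_kernel_eq_integral pos_divide_le_eq)
  have "integral {t k..t (Suc k)} (\<lambda>s. R * omega (1 - \<alpha>) (t n - s)) \<le>
        integral {t k..t (Suc k)} (\<lambda>s. omega (1 - \<alpha>) (t j - s))"
    unfolding integral_open_interval_real R_def
    by (rule integral_le) (use o in \<open>auto intro!: omega_ratio_right \<alpha> integrable_on_cmult_left omega_integrable simp: integrable_on_open_interval_real\<close>)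
  then have right: "R * L1_kernel \<alpha> t n (n - Suc k) \<le> L1_kernel \<alpha> t j (j - Suc k)"
    using assms o by (simp add: L1_kernel_eq_integral pos_le_divide_eq)
  have "L1_kernel \<alpha> t j (j - k) * L1_kernel \<alpha> t n (n - Suc k) \<le> R * L1_kernel \<alpha> t n (n - k) * L1_kernel \<alpha> t n (n - Suc k)"
    using L1_kernel_pos[of "Suc k" n] assms by (intro mult_right_mono left) auto
  also have "\<dots> = L1_kernel \<alpha> t n (n - k) * (R * L1_kernel \<alpha> t n (n - Suc k))" by simp
  also have "\<dots> \<le> L1_kernel \<alpha> t n (n - k) * L1_kernel \<alpha> t j (j - Suc k)"
    using L1_kernel_pos[of k n] assms by (intro mult_left_mono right) auto
  finally show ?thesis .
qed

lemma L1_kernel_antimono: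
  assumes "1 \<le> k" "k \<le> j" "j \<le> n" "n \<le> N"
  shows "L1_kernel \<alpha> t n (n - k) \<le> L1_kernel \<alpha> t j (j - k)"
proof -
  have o: "t (k - 1) < t k" "t k \<le> t j" "t j \<le> t n"
    using assms mesh_strict_mono[of "k-1" k] mesh_mono[of k j] mesh_mono[of j n] by auto
  have Gp: "Gamma (1 - \<alpha>) > 0" using \<alpha> by (intro Gamma_real_pos) auto
  have "omega (1 - \<alpha>) (t n - s) \<le> omega (1 - \<alpha>) (t j - s)" if "s < t j" for s
    unfolding omega_def using that o \<alpha> Gp by (intro divide_right_mono powr_mono2') auto
  then have "integral {t (k-1)..t k} (\<lambda>s. omega (1 - \<alpha>) (t n - s)) \<le>
        integral {t (k-1)..t k} (\<lambda>s. omega (1 - \<alpha>) (t j - s))"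
    unfolding integral_open_interval_real
    by (intro integral_le) (use o in \<open>auto intro!: omega_integrable simp: integrable_on_open_interval_real\<close>)
  then show ?thesis using assms o by (simp add: L1_kernel_eq_integral divide_right_mono)
qed

lemma DOC_kernel_diag_pos:
  assumes "1 \<le> n" "n \<le> N"
  shows "DOC_kernel \<alpha> t n 0 > 0"
  using L1_kernel_pos[of n n] assms by (simp add: DOC_kernel_diag)

lemma DOC_kernel_nonpos:
  assumes "1 \<le> k" "k < n" "n \<le> N"
  shows "DOC_kernel \<alpha> t n (n - k) \<le> 0"
proof -
  have nz: "L1_kernel \<alpha> t k 0 \<noteq> 0" if "1 \<le> k" "k \<le> n" for k
    using L1_kernel_pos[of k k] that assms by simp
  show ?thesis
    using orthogonal_kernel_nonpos[of n "\<lambda>n k. L1_kernel \<alpha> t n (n - k)" "\<lambda>n k. DOC_kernel \<alpha> t n (n - k)" k]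
      L1_kernel_pos L1_kernel_cross DOC_kernel_orthogonal nz DOC_kernel_diag_pos assms
    by simp
qed

lemma DOC_kernel_sum_nonneg:
  assumes "1 \<le> n" "n \<le> N"
  shows "(\<Sum>j=1..n. DOC_kernel \<alpha> t n (n - j)) \<ge> 0"
  using orthogonal_kernel_sum_nonneg[of "\<lambda>n k. L1_kernel \<alpha> t n (n - k)" n "\<lambda>n k. DOC_kernel \<alpha> t n (n - k)"]
    L1_kernel_pos[of 1 n] L1_kernel_pos[of 1 1] L1_kernel_antimono[of 1] DOC_kernel_orthogonal[of 1 n \<alpha> t]
    DOC_kernel_nonpos DOC_kernel_diag_pos assms
  by simp

end

lemma DOC_kernel_step_bound:
  assumes "0 < \<alpha>" "\<alpha> < 1" "\<kappa> > 0" "\<epsilon> > 0" "\<forall>n\<in>{1..N}. t (n - 1) < t n" "n \<in> {1..N}"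
    and "time_step t n \<le> (4 * \<epsilon>\<^sup>2 / (\<kappa> * Gamma (2 - \<alpha>))) powr (1 / \<alpha>)"
  shows "\<kappa> * DOC_kernel \<alpha> t n 0 \<le> 4 * \<epsilon>\<^sup>2"
proof -
  have G: "Gamma (2 - \<alpha>) > 0" using assms by (intro Gamma_real_pos) auto
  have X: "4 * \<epsilon>\<^sup>2 / (\<kappa> * Gamma (2 - \<alpha>)) > 0" using assms G by simp
  have "0 < time_step t n" using assms(5,6) by (simp add: time_step_def)
  then have "time_step t n powr \<alpha> \<le> ((4 * \<epsilon>\<^sup>2 / (\<kappa> * Gamma (2 - \<alpha>))) powr (1 / \<alpha>)) powr \<alpha>"
    using assms by (intro powr_mono2) auto
  also have "\<dots> = 4 * \<epsilon>\<^sup>2 / (\<kappa> * Gamma (2 - \<alpha>))"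
    using assms X by (simp add: powr_powr)
  finally have "\<kappa> * (Gamma (2 - \<alpha>) * time_step t n powr \<alpha>) \<le> 4 * \<epsilon>\<^sup>2"
    using G assms by (simp add: field_simps)
  then show ?thesis
    using L1_kernel_diag[of \<alpha> N t n] assms by (simp add: DOC_kernel_diag)
qed

text \<open>
  The complementary kernels are column sums of the orthogonal kernels, so passing from \<open>n - 1\<close> to \<open>n\<close>
  adds the row \<open>n\<close>.
\<close>

lemma DCC_kernel_sum_diff:
  assumes "1 \<le> n"
  shows "(\<Sum>j=1..n. DCC_kernel \<alpha> t n (n - j) * X j) - (\<Sum>j=1..n-1. DCC_kernel \<alpha> t (n - 1) (n - 1 - j) * X j)
    = (\<Sum>j=1..n. DOC_kernel \<alpha> t n (n - j) * X j)"
proof -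
  obtain m where m: "n = Suc m" using assms by (cases n) auto
  have D: "DCC_kernel \<alpha> t i (i - j) = (\<Sum>l=j..i. DOC_kernel \<alpha> t l (l - j))" if "j \<le> i" for i j
    using that by (simp add: DCC_kernel_def Let_def)
  have "DCC_kernel \<alpha> t (Suc m) (Suc m - j) = DCC_kernel \<alpha> t m (m - j) + DOC_kernel \<alpha> t (Suc m) (Suc m - j)"
    if "j \<le> m" for j using that by (subst (1 2) D) auto
  moreover have "DCC_kernel \<alpha> t (Suc m) 0 = DOC_kernel \<alpha> t (Suc m) 0"
    using D[of "Suc m" "Suc m"] by simp
  moreover from calculation have "(\<Sum>j=1..m. DCC_kernel \<alpha> t (Suc m) (Suc m - j) * X j) =
      (\<Sum>j=1..m. DCC_kernel \<alpha> t m (m - j) * X j + DOC_kernel \<alpha> t (Suc m) (Suc m - j) * X j)"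
    by (intro sum.cong) (auto simp: distrib_right)
  ultimately show ?thesis unfolding m by (simp add: sum.distrib)
qed

section \<open>Calculus of the \<open>L\<^sup>2\<close> inner product\<close>

lemma square_integrable_inner:
  assumes f: "square_integrable \<Omega> f" and g: "square_integrable \<Omega> g"
  shows "set_integrable lborel \<Omega> (\<lambda>x. f x \<bullet> g x)"
  unfolding set_integrable_def
proof (rule Bochner_Integration.integrable_bound)
  have m: "(\<lambda>x. indicator \<Omega> x *\<^sub>R f x) \<in> borel_measurable lborel" "(\<lambda>x. indicator \<Omega> x *\<^sub>R g x) \<in> borel_measurable lborel"
    using f g by (simp_all add: square_integrable_def set_borel_measurable_def)
  have "indicator \<Omega> x *\<^sub>R (f x \<bullet> g x) = (indicator \<Omega> x *\<^sub>R f x) \<bullet> (indicator \<Omega> x *\<^sub>R g x)" for x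
    by (simp split: split_indicator)
  then show "(\<lambda>x. indicator \<Omega> x *\<^sub>R (f x \<bullet> g x)) \<in> borel_measurable lborel"
    using borel_measurable_inner[OF m] by presburger
  show "integrable lborel (\<lambda>x. indicator \<Omega> x *\<^sub>R (norm (f x))\<^sup>2 + indicator \<Omega> x *\<^sub>R (norm (g x))\<^sup>2)"
    using f g by (auto simp: square_integrable_def set_integrable_def)
  have "\<bar>f x \<bullet> g x\<bar> \<le> (norm (f x))\<^sup>2 + (norm (g x))\<^sup>2" for x
  proof -
    have "\<bar>f x \<bullet> g x\<bar> \<le> norm (f x) * norm (g x)" by (rule Cauchy_Schwarz_ineq2)
    moreover have "2 * norm (f x) * norm (g x) \<le> (norm (f x))\<^sup>2 + (norm (g x))\<^sup>2" by (rule sum_squares_bound)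
    moreover have "0 \<le> norm (f x) * norm (g x)" by simp
    ultimately show ?thesis by linarith
  qed
  then show "AE x in lborel. norm (indicator \<Omega> x *\<^sub>R (f x \<bullet> g x)) \<le>
      norm (indicator \<Omega> x *\<^sub>R (norm (f x))\<^sup>2 + indicator \<Omega> x *\<^sub>R (norm (g x))\<^sup>2)"
    by (auto split: split_indicator)
qed

lemma square_integrable_scaleR:
  assumes "square_integrable \<Omega> f"
  shows "square_integrable \<Omega> (\<lambda>x. c *\<^sub>R f x)"
proof -
  have "(\<lambda>x. c *\<^sub>R (indicator \<Omega> x *\<^sub>R f x)) \<in> borel_measurable lborel"
    using assms unfolding square_integrable_def set_borel_measurable_def
    by (intro borel_measurable_scaleR[OF borel_measurable_const]) simp
  moreover have "set_integrable lborel \<Omega> (\<lambda>x. c\<^sup>2 * (norm (f x))\<^sup>2)"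
    using assms by (auto simp: square_integrable_def)
  ultimately show ?thesis
    by (simp add: square_integrable_def set_borel_measurable_def mult.commute[of c] power_mult_distrib)
qed

lemma square_integrable_add:
  assumes f: "square_integrable \<Omega> f" and g: "square_integrable \<Omega> g"
  shows "square_integrable \<Omega> (\<lambda>x. f x + g x)"
proof -
  have "(\<lambda>x. indicator \<Omega> x *\<^sub>R f x + indicator \<Omega> x *\<^sub>R g x) \<in> borel_measurable lborel"
    using f g unfolding square_integrable_def set_borel_measurable_def by (intro borel_measurable_add) auto
  moreover have "set_integrable lborel \<Omega> (\<lambda>x. (norm (f x))\<^sup>2 + 2 * (f x \<bullet> g x) + (norm (g x))\<^sup>2)"
    using f g square_integrable_inner[OF f g] by (intro set_integral_add set_integrable_mult_right) (auto simp: square_integrable_def)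
  moreover have "(norm (f x + g x))\<^sup>2 = (norm (f x))\<^sup>2 + 2 * (f x \<bullet> g x) + (norm (g x))\<^sup>2" for x
    by (simp add: power2_norm_eq_inner inner_add_left inner_add_right inner_commute)
  ultimately show ?thesis
    by (simp add: square_integrable_def set_borel_measurable_def scaleR_add_right)
qed

lemma square_integrable_diff:
  assumes "square_integrable \<Omega> f" "square_integrable \<Omega> g"
  shows "square_integrable \<Omega> (\<lambda>x. f x - g x)"
  using square_integrable_add[OF assms(1) square_integrable_scaleR[OF assms(2), of "-1"]] by simp

lemma square_integrable_sum:
  assumes "\<And>j. j \<in> J \<Longrightarrow> square_integrable \<Omega> (f j)"
  shows "square_integrable \<Omega> (\<lambda>x. \<Sum>j\<in>J. f j x)"
  using assms
proof (induction J rule: infinite_finite_induct)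
  case (insert j J)
  then show ?case by (simp add: square_integrable_add)
qed (simp_all add: square_integrable_def set_borel_measurable_def set_integrable_def)

lemma l2_inner_commute: "l2_inner \<Omega> f g = l2_inner \<Omega> g f"
  by (simp add: l2_inner_def inner_commute)

lemma l2_inner_diff_right:
  assumes "square_integrable \<Omega> f" "square_integrable \<Omega> g" "square_integrable \<Omega> h"
  shows "l2_inner \<Omega> f (\<lambda>x. g x - h x) = l2_inner \<Omega> f g - l2_inner \<Omega> f h"
  unfolding l2_inner_def inner_diff_right
  using assms by (intro set_integral_diff square_integrable_inner)

lemma l2_inner_diff_left:
  assumes "square_integrable \<Omega> f" "square_integrable \<Omega> g" "square_integrable \<Omega> h"
  shows "l2_inner \<Omega> (\<lambda>x. g x - h x) f = l2_inner \<Omega> g f - l2_inner \<Omega> h f"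
  using l2_inner_diff_right[OF assms] by (simp add: l2_inner_commute)

lemma l2_inner_sum_left:
  assumes "\<And>j. j \<in> J \<Longrightarrow> square_integrable \<Omega> (f j)" "square_integrable \<Omega> g"
  shows "l2_inner \<Omega> (\<lambda>x. \<Sum>j\<in>J. c j *\<^sub>R f j x) g = (\<Sum>j\<in>J. c j * l2_inner \<Omega> (f j) g)"
proof -
  have "integrable lborel (\<lambda>x. c j * (indicator \<Omega> x * (f j x \<bullet> g x)))" if "j \<in> J" for j
    using square_integrable_inner[OF assms(1)[OF that] assms(2)] by (simp add: set_integrable_def)
  then have "(LINT x|lborel. (\<Sum>j\<in>J. c j * (indicator \<Omega> x * (f j x \<bullet> g x))))
      = (\<Sum>j\<in>J. (LINT x|lborel. c j * (indicator \<Omega> x * (f j x \<bullet> g x))))"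
    by (rule Bochner_Integration.integral_sum)
  then show ?thesis
    by (simp add: l2_inner_def set_lebesgue_integral_def inner_sum_left sum_distrib_left mult.left_commute)
qed

lemma l2_norm_power2: "(l2_norm \<Omega> f)\<^sup>2 = l2_inner \<Omega> f f"
proof -
  have "0 \<le> l2_inner \<Omega> f f" by (simp add: l2_inner_def set_lebesgue_integral_def)
  then show ?thesis by (simp add: l2_norm_def)
qed

lemma H1_periodic_square_integrable:
  assumes "u \<in> H1_periodic p q"
  shows "square_integrable (box p q) u" "square_integrable (box p q) (weak_gradient p q u)"
proof -
  have "has_weak_gradient p q u (weak_gradient p q u)"
    using assms someI_ex[of "has_weak_gradient p q u"] unfolding H1_periodic_def weak_gradient_def by blast
  then show "square_integrable (box p q) u" "square_integrable (box p q) (weak_gradient p q u)"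
    by (auto simp: has_weak_gradient_def)
qed

lemma l2_inner_increment_sum:
  fixes \<phi> :: "nat \<Rightarrow> real \<times> real \<Rightarrow> real"
  assumes "\<And>k. k \<le> n \<Longrightarrow> square_integrable \<Omega> (\<phi> k)" "square_integrable \<Omega> v"
  shows "l2_inner \<Omega> (\<lambda>x. \<Sum>k=1..n. c k * (\<phi> k x - \<phi> (k - 1) x)) v =
    (\<Sum>k=1..n. c k * l2_inner \<Omega> (\<lambda>x. \<phi> k x - \<phi> (k - 1) x) v)"
proof -
  have "square_integrable \<Omega> (\<lambda>x. \<phi> k x - \<phi> (k - 1) x)" if "k \<in> {1..n}" for k
    using that assms(1)[of k] assms(1)[of "k - 1"] by (intro square_integrable_diff) auto
  then have "l2_inner \<Omega> (\<lambda>x. \<Sum>k=1..n. c k *\<^sub>R (\<phi> k x - \<phi> (k - 1) x)) v =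
      (\<Sum>k=1..n. c k * l2_inner \<Omega> (\<lambda>x. \<phi> k x - \<phi> (k - 1) x) v)"
    by (intro l2_inner_sum_left assms(2))
  then show ?thesis by simp
qed

section \<open>The change of the energy in one time step\<close>

text \<open>
  The Cauchy-Schwarz inequality with the weights split as \<open>c = \<surd>c \<cdot> \<surd>c\<close>.
\<close>

lemma weighted_norm_sum_power2_le:
  fixes m :: "nat \<Rightarrow> 'a::real_inner"
  assumes "\<And>j. j \<in> J \<Longrightarrow> c j \<ge> 0" "finite J"
  shows "(norm (\<Sum>j\<in>J. c j *\<^sub>R m j))\<^sup>2 \<le> (\<Sum>j\<in>J. c j) * (\<Sum>j\<in>J. c j * (norm (m j))\<^sup>2)"
proof -
  have "norm (\<Sum>j\<in>J. c j *\<^sub>R m j) \<le> (\<Sum>j\<in>J. sqrt (c j) * (sqrt (c j) * norm (m j)))"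
    using assms by (intro norm_sum[THEN order_trans]) (auto intro!: sum_mono simp flip: mult.assoc)
  then have "(norm (\<Sum>j\<in>J. c j *\<^sub>R m j))\<^sup>2 \<le> (\<Sum>j\<in>J. sqrt (c j) * (sqrt (c j) * norm (m j)))\<^sup>2"
    by (intro power_mono) auto
  also have "\<dots> \<le> (\<Sum>j\<in>J. (sqrt (c j))\<^sup>2) * (\<Sum>j\<in>J. (sqrt (c j) * norm (m j))\<^sup>2)"
    by (rule Cauchy_Schwarz_ineq_sum)
  also have "\<dots> = (\<Sum>j\<in>J. c j) * (\<Sum>j\<in>J. c j * (norm (m j))\<^sup>2)"
    using assms by (auto intro!: arg_cong2[where f = "(*)"] sum.cong simp: power_mult_distrib)
  finally show ?thesis .
qed

text \<open>
  Write \<open>w = \<theta>\<^sub>n m\<^sub>n - r\<close>. Completing the square cancels everything that contains \<open>m\<^sub>n\<close> and leaves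
  \<open>\<bar>r\<bar>\<^sup>2 / \<theta>\<^sub>n\<close> minus the sum of \<open>- \<theta>\<^sub>j \<bar>m\<^sub>j\<bar>\<^sup>2\<close> over \<open>j < n\<close>. The weighted Cauchy-Schwarz inequality makes this
  non-positive, because the weights \<open>- \<theta>\<^sub>j\<close> are non-negative with sum at most \<open>\<theta>\<^sub>n\<close>.
\<close>

lemma kernel_quadratic_form_nonpos:
  fixes m :: "nat \<Rightarrow> 'a::real_inner" and \<theta> :: "nat \<Rightarrow> real"
  assumes n: "1 \<le> n" and diag: "\<theta> n > 0" and nonpos: "\<And>j. 1 \<le> j \<Longrightarrow> j < n \<Longrightarrow> \<theta> j \<le> 0"
    and sum: "(\<Sum>j=1..n. \<theta> j) \<ge> 0"
  defines "w \<equiv> \<Sum>j=1..n. \<theta> j *\<^sub>R m j"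
  shows "(\<Sum>j=1..n. \<theta> j * (norm (m j))\<^sup>2) - 2 * (w \<bullet> m n) + (norm w)\<^sup>2 / \<theta> n \<le> 0"
proof -
  define r where "r = (\<Sum>j=1..<n. (- \<theta> j) *\<^sub>R m j)"
  define s where "s = (\<Sum>j=1..<n. (- \<theta> j) * (norm (m j))\<^sup>2)"
  have split: "(\<Sum>j=1..n. f j) = f n + (\<Sum>j=1..<n. f j)" for f :: "nat \<Rightarrow> 'b::ab_group_add"
    using n by (metis add.commute atLeastLessThanSuc_atLeastAtMost sum.atLeastLessThan_Suc)
  have w: "w = \<theta> n *\<^sub>R m n - r"
    unfolding w_def r_def by (subst split) (simp add: sum_negf)
  have "(norm r)\<^sup>2 \<le> (\<Sum>j=1..<n. - \<theta> j) * s"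
    unfolding r_def s_def by (rule weighted_norm_sum_power2_le) (auto simp: nonpos)
  also have "\<dots> \<le> \<theta> n * s"
    using sum unfolding split[of \<theta>] s_def
    by (intro mult_right_mono sum_nonneg mult_nonneg_nonneg) (auto simp: nonpos sum_negf)
  finally have "(norm r)\<^sup>2 / \<theta> n \<le> s" using diag by (simp add: field_simps)
  moreover have "(norm w)\<^sup>2 / \<theta> n = \<theta> n * (norm (m n))\<^sup>2 - 2 * (r \<bullet> m n) + (norm r)\<^sup>2 / \<theta> n"
    using diag unfolding w power2_norm_eq_inner
    by (simp add: inner_diff_left inner_diff_right inner_commute field_simps)
  moreover have "w \<bullet> m n = \<theta> n * (norm (m n))\<^sup>2 - r \<bullet> m n"
    unfolding w by (simp add: inner_diff_left power2_norm_eq_inner)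
  moreover have "(\<Sum>j=1..n. \<theta> j * (norm (m j))\<^sup>2) = \<theta> n * (norm (m n))\<^sup>2 - s"
    unfolding s_def by (subst split) (simp add: sum_negf)
  ultimately show ?thesis by linarith
qed

text \<open>
  Young's inequality with weight \<open>\<theta>\<^sub>n\<close> bounds the term \<open>- \<kappa> / 2 \<cdot> w \<bullet> d\<close> by \<open>\<kappa> / 2 \<cdot> \<bar>w\<bar>\<^sup>2 / \<theta>\<^sub>n\<close>, which the
  quadratic form absorbs, plus \<open>\<kappa> \<theta>\<^sub>n / 8 \<cdot> \<bar>d\<bar>\<^sup>2\<close>, which the term \<open>\<epsilon>\<^sup>2 / 2 \<cdot> \<bar>d\<bar>\<^sup>2\<close> absorbs by the step
  condition.
\<close>

lemma energy_increment_density_nonpos: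
  fixes m :: "nat \<Rightarrow> 'a::real_inner" and \<theta> :: "nat \<Rightarrow> real" and d :: 'a
  assumes n: "1 \<le> n" and diag: "\<theta> n > 0" and nonpos: "\<And>j. 1 \<le> j \<Longrightarrow> j < n \<Longrightarrow> \<theta> j \<le> 0"
    and sum: "(\<Sum>j=1..n. \<theta> j) \<ge> 0"
    and "\<kappa> > 0" "\<epsilon> > 0" and step: "\<kappa> * \<theta> n \<le> 4 * \<epsilon>\<^sup>2"
  defines "w \<equiv> \<Sum>j=1..n. \<theta> j *\<^sub>R m j"
  shows "\<kappa> / 2 * (\<Sum>j=1..n. \<theta> j * (norm (m j))\<^sup>2) - \<kappa> * (w \<bullet> m n) - \<kappa> / 2 * (w \<bullet> d) - \<epsilon>\<^sup>2 / 2 * (norm d)\<^sup>2 \<le> 0"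
proof -
  have q: "(\<Sum>j=1..n. \<theta> j * (norm (m j))\<^sup>2) - 2 * (w \<bullet> m n) + (norm w)\<^sup>2 / \<theta> n \<le> 0"
    unfolding w_def using assms by (intro kernel_quadratic_form_nonpos) auto
  have "0 \<le> (norm (w + (\<theta> n / 2) *\<^sub>R d))\<^sup>2" by simp
  also have "\<dots> = (norm w)\<^sup>2 + \<theta> n * (w \<bullet> d) + (\<theta> n)\<^sup>2 / 4 * (norm d)\<^sup>2"
    unfolding power2_norm_eq_inner
    by (simp add: inner_add_left inner_add_right inner_commute power2_eq_square)
  finally have "0 \<le> ((norm w)\<^sup>2 + \<theta> n * (w \<bullet> d) + (\<theta> n)\<^sup>2 / 4 * (norm d)\<^sup>2) / \<theta> n"
    using diag by simp
  also have "\<dots> = (norm w)\<^sup>2 / \<theta> n + w \<bullet> d + \<theta> n / 4 * (norm d)\<^sup>2"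
    using diag by (simp add: field_simps power2_eq_square)
  finally have young: "0 \<le> (norm w)\<^sup>2 / \<theta> n + w \<bullet> d + \<theta> n / 4 * (norm d)\<^sup>2" .
  have "\<kappa> / 2 * ((\<Sum>j=1..n. \<theta> j * (norm (m j))\<^sup>2) - 2 * (w \<bullet> m n) + (norm w)\<^sup>2 / \<theta> n) \<le> 0"
    using q \<open>\<kappa> > 0\<close> by (simp add: mult_le_0_iff)
  moreover have "0 \<le> \<kappa> / 2 * ((norm w)\<^sup>2 / \<theta> n + w \<bullet> d + \<theta> n / 4 * (norm d)\<^sup>2)"
    using young \<open>\<kappa> > 0\<close> by simp
  moreover have "\<kappa> * \<theta> n * (norm d)\<^sup>2 \<le> 4 * \<epsilon>\<^sup>2 * (norm d)\<^sup>2"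
    using step by (rule mult_right_mono) simp
  ultimately show ?thesis by (simp add: algebra_simps)
qed

lemma power3_mult_bound: "\<bar>x ^ 3 * y\<bar> \<le> x ^ 4 + (y::real) ^ 4"
proof -
  have "\<bar>x ^ 3 * y\<bar> \<le> max \<bar>x\<bar> \<bar>y\<bar> ^ 3 * max \<bar>x\<bar> \<bar>y\<bar>"
    unfolding abs_mult power_abs by (intro mult_mono power_mono) auto
  also have "\<dots> = max \<bar>x\<bar> \<bar>y\<bar> ^ 4" by (simp add: power_numeral_reduce mult_ac)
  also have "\<dots> \<le> x ^ 4 + y ^ 4" by (auto simp: max_def)
  finally show ?thesis .
qed

lemma set_borel_measurable_compose_fun:
  fixes f :: "'a \<Rightarrow> real" and h :: "real \<Rightarrow> real"
  assumes "set_borel_measurable M \<Omega> f" "h \<in> borel_measurable borel" "\<Omega> \<in> sets M"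
  shows "set_borel_measurable M \<Omega> (\<lambda>x. h (f x))"
proof -
  have "(\<lambda>x. h (indicator \<Omega> x *\<^sub>R f x)) \<in> borel_measurable M"
    using assms(1) unfolding set_borel_measurable_def by (rule measurable_compose) (rule assms(2))
  then have "(\<lambda>x. indicator \<Omega> x *\<^sub>R h (indicator \<Omega> x *\<^sub>R f x)) \<in> borel_measurable M"
    by (intro borel_measurable_scaleR borel_measurable_indicator assms(3))
  moreover have "indicator \<Omega> x *\<^sub>R h (indicator \<Omega> x *\<^sub>R f x) = indicator \<Omega> x *\<^sub>R h (f x)" for x
    by (simp split: split_indicator)
  ultimately show ?thesis by (simp only: set_borel_measurable_def)
qed

text \<open>
  By Young's inequality \<open>\<bar>u\<^sup>3 v\<bar> \<le> u\<^sup>4 + v\<^sup>4\<close>.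
\<close>

lemma cubic_inner_integrable:
  assumes pq: "fst p < fst q" "snd p < snd q" and u: "u \<in> H1_periodic p q" and v: "v \<in> H1_periodic p q"
  shows "set_integrable lborel (box p q) (\<lambda>x. ((u x) ^ 3 - u x) \<bullet> v x)"
proof -
  let ?\<Omega> = "box p q"
  have "set_integrable lborel ?\<Omega> (\<lambda>x. (u x) ^ 3 * v x)"
  proof (rule set_integrable_bound)
    show "set_integrable lborel ?\<Omega> (\<lambda>x. (u x) ^ 4 + (v x) ^ 4)"
      using H1_periodic_L4[OF pq u] H1_periodic_L4[OF pq v] by (rule set_integral_add)
    have "set_borel_measurable lborel ?\<Omega> (\<lambda>x. (u x) ^ 3)" "set_borel_measurable lborel ?\<Omega> v"
      using H1_periodic_square_integrable(1)[OF u] H1_periodic_square_integrable(1)[OF v]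
      by (auto simp: square_integrable_def intro!: set_borel_measurable_compose_fun[where h = "\<lambda>x. x ^ 3"])
    then have "(\<lambda>x. (indicator ?\<Omega> x *\<^sub>R (u x) ^ 3) * (indicator ?\<Omega> x *\<^sub>R v x)) \<in> borel_measurable lborel"
      unfolding set_borel_measurable_def by (rule borel_measurable_times)
    moreover have "(indicator ?\<Omega> x *\<^sub>R (u x) ^ 3) * (indicator ?\<Omega> x *\<^sub>R v x) = indicator ?\<Omega> x *\<^sub>R ((u x) ^ 3 * v x)" for x
      by (simp split: split_indicator)
    ultimately show "set_borel_measurable lborel ?\<Omega> (\<lambda>x. (u x) ^ 3 * v x)"
      by (simp only: set_borel_measurable_def)
    show "AE x in lborel. x \<in> ?\<Omega> \<longrightarrow> norm ((u x) ^ 3 * v x) \<le> norm ((u x) ^ 4 + (v x) ^ 4)"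
      using power3_mult_bound by (auto intro!: AE_I2 order_trans[OF _ abs_ge_self])
  qed
  then have "set_integrable lborel ?\<Omega> (\<lambda>x. (u x) ^ 3 * v x - u x \<bullet> v x)"
    using square_integrable_inner[OF H1_periodic_square_integrable(1)[OF u] H1_periodic_square_integrable(1)[OF v]]
    by (rule set_integral_diff)
  then show ?thesis by (simp add: left_diff_distrib)
qed

lemma double_well_integrable:
  assumes pq: "fst p < fst q" "snd p < snd q" and u: "u \<in> H1_periodic p q"
  shows "set_integrable lborel (box p q) (\<lambda>x. double_well (u x))"
proof -
  have "integrable lborel (indicator (box p q) :: real \<times> real \<Rightarrow> real)"
    by (rule integrable_real_indicator) (auto simp: emeasure_lborel_box_eq)
  then have c: "set_integrable lborel (box p q) (\<lambda>x. 1 / 4 :: real)"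
    unfolding set_integrable_def by (rule integrable_scaleR_left)
  have "set_integrable lborel (box p q) (\<lambda>x. 1 / 4 * (u x) ^ 4 - 1 / 2 * (u x \<bullet> u x) + 1 / 4)"
    using H1_periodic_L4[OF pq u] square_integrable_inner[OF H1_periodic_square_integrable(1)[OF u] H1_periodic_square_integrable(1)[OF u]]
    by (intro set_integral_add set_integral_diff set_integrable_mult_right c) auto
  moreover have "1 / 4 * z ^ 4 - 1 / 2 * (z \<bullet> z) + 1 / 4 = double_well z" for z :: real
    by (simp add: double_well_def power2_eq_square power4_eq_xxxx algebra_simps)
  ultimately show ?thesis by simp
qed

text \<open>
  The second derivative of the double well is at least \<open>- 1\<close>; explicitly, the difference of the two sides
  is a square times a sum of squares.
\<close>

lemma double_well_diff_le:
  "double_well a - double_well b \<le> (a ^ 3 - a) * (a - b) + 1 / 2 * (a - b)\<^sup>2"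
proof -
  have "(a ^ 3 - a) * (a - b) + 1 / 2 * (a - b)\<^sup>2 - (double_well a - double_well b)
    = 1 / 4 * (a - b)\<^sup>2 * (2 * a\<^sup>2 + (a + b)\<^sup>2)"
    by (simp add: double_well_def power2_eq_square power3_eq_cube algebra_simps)
  also have "\<dots> \<ge> 0" by simp
  finally show ?thesis by simp
qed

text \<open>
  The gradient part is the identity \<open>\<bar>x\<bar>\<^sup>2 - \<bar>y\<bar>\<^sup>2 = 2 x \<bullet> (x - y) - \<bar>x - y\<bar>\<^sup>2\<close>, and the potential part integrates
  \<open>double_well_diff_le\<close>. The embedding into \<open>L\<^sup>4\<close> enters here: it makes the potential and the cubic term
  integrable. The inner products of the cubic term with \<open>u\<close> and \<open>v\<close> are kept apart because this is the form
  in which the scheme supplies them.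
\<close>

lemma energy_diff_le:
  assumes pq: "fst p < fst q" "snd p < snd q"
    and u: "u \<in> H1_periodic p q" and v: "v \<in> H1_periodic p q"
  defines "d \<equiv> \<lambda>x. weak_gradient p q u x - weak_gradient p q v x"
  shows "energy p q \<epsilon> u - energy p q \<epsilon> v \<le>
    (l2_inner (box p q) (\<lambda>x. (u x) ^ 3 - u x) u - l2_inner (box p q) (\<lambda>x. (u x) ^ 3 - u x) v) +
    1 / 2 * l2_inner (box p q) (\<lambda>x. u x - v x) (\<lambda>x. u x - v x) +
    \<epsilon>\<^sup>2 * l2_inner (box p q) (weak_gradient p q u) d - \<epsilon>\<^sup>2 / 2 * l2_inner (box p q) d d"
proof -
  let ?\<Omega> = "box p q"
  note su = H1_periodic_square_integrable[OF u] and sv = H1_periodic_square_integrable[OF v]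
  have sd: "square_integrable ?\<Omega> d" unfolding d_def using su sv by (intro square_integrable_diff)
  have suv: "square_integrable ?\<Omega> (\<lambda>x. u x - v x)" using su sv by (intro square_integrable_diff)
  have "(LINT x:?\<Omega>|lborel. double_well (u x)) - (LINT x:?\<Omega>|lborel. double_well (v x)) =
      (LINT x:?\<Omega>|lborel. double_well (u x) - double_well (v x))"
    using double_well_integrable[OF pq] u v by (intro set_integral_diff(2)[symmetric])
  also have "\<dots> \<le> (LINT x:?\<Omega>|lborel. (((u x) ^ 3 - u x) \<bullet> u x - ((u x) ^ 3 - u x) \<bullet> v x) + 1 / 2 * ((u x - v x) \<bullet> (u x - v x)))"
  proof (rule set_integral_mono)
    show "set_integrable lborel ?\<Omega> (\<lambda>x. double_well (u x) - double_well (v x))"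
      using double_well_integrable[OF pq] u v by (intro set_integral_diff(1))
    show "set_integrable lborel ?\<Omega> (\<lambda>x. (((u x) ^ 3 - u x) \<bullet> u x - ((u x) ^ 3 - u x) \<bullet> v x) + 1 / 2 * ((u x - v x) \<bullet> (u x - v x)))"
      using cubic_inner_integrable[OF pq u u] cubic_inner_integrable[OF pq u v] square_integrable_inner[OF suv suv]
      by (intro set_integral_add(1) set_integral_diff(1) set_integrable_mult_right)
    fix x
    show "double_well (u x) - double_well (v x) \<le> (((u x) ^ 3 - u x) \<bullet> u x - ((u x) ^ 3 - u x) \<bullet> v x) + 1 / 2 * ((u x - v x) \<bullet> (u x - v x))"
      using double_well_diff_le[of "u x" "v x"] by (simp add: right_diff_distrib power2_eq_square)
  qed
  also have "\<dots> = (l2_inner ?\<Omega> (\<lambda>x. (u x) ^ 3 - u x) u - l2_inner ?\<Omega> (\<lambda>x. (u x) ^ 3 - u x) v) +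
      1 / 2 * l2_inner ?\<Omega> (\<lambda>x. u x - v x) (\<lambda>x. u x - v x)"
    unfolding l2_inner_def
    using cubic_inner_integrable[OF pq u u] cubic_inner_integrable[OF pq u v] square_integrable_inner[OF suv suv]
    by (simp only: set_integral_add(2) set_integral_diff set_integral_mult_right set_integrable_mult_right)
  finally have pot: "l2_inner ?\<Omega> (\<lambda>x. double_well (u x)) (\<lambda>x. 1) - l2_inner ?\<Omega> (\<lambda>x. double_well (v x)) (\<lambda>x. 1) \<le>
      (l2_inner ?\<Omega> (\<lambda>x. (u x) ^ 3 - u x) u - l2_inner ?\<Omega> (\<lambda>x. (u x) ^ 3 - u x) v) +
      1 / 2 * l2_inner ?\<Omega> (\<lambda>x. u x - v x) (\<lambda>x. u x - v x)"
    by (simp add: l2_inner_def)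
  have "l2_inner ?\<Omega> (weak_gradient p q u) d = l2_inner ?\<Omega> (weak_gradient p q u) (weak_gradient p q u) - l2_inner ?\<Omega> (weak_gradient p q u) (weak_gradient p q v)"
    unfolding d_def using su sv by (intro l2_inner_diff_right)
  moreover have "l2_inner ?\<Omega> (weak_gradient p q v) d = l2_inner ?\<Omega> (weak_gradient p q u) (weak_gradient p q v) - l2_inner ?\<Omega> (weak_gradient p q v) (weak_gradient p q v)"
    unfolding d_def using su sv
    by (subst l2_inner_diff_right) (auto simp: l2_inner_commute)
  moreover have "l2_inner ?\<Omega> d d = l2_inner ?\<Omega> (weak_gradient p q u) d - l2_inner ?\<Omega> (weak_gradient p q v) d"
    using l2_inner_diff_left[OF sd su(2) sv(2)] by (simp add: d_def)
  ultimately have "(l2_norm ?\<Omega> (weak_gradient p q u))\<^sup>2 - (l2_norm ?\<Omega> (weak_gradient p q v))\<^sup>2 =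
      2 * l2_inner ?\<Omega> (weak_gradient p q u) d - l2_inner ?\<Omega> d d"
    by (simp add: l2_norm_power2)
  then have "\<epsilon>\<^sup>2 / 2 * ((l2_norm ?\<Omega> (weak_gradient p q u))\<^sup>2 - (l2_norm ?\<Omega> (weak_gradient p q v))\<^sup>2) =
      \<epsilon>\<^sup>2 * l2_inner ?\<Omega> (weak_gradient p q u) d - \<epsilon>\<^sup>2 / 2 * l2_inner ?\<Omega> d d"
    by (simp add: right_diff_distrib)
  with pot show ?thesis unfolding energy_def right_diff_distrib by linarith
qed

lemma integrated_energy_increment_nonpos:
  fixes m :: "nat \<Rightarrow> real \<times> real \<Rightarrow> 'a::euclidean_space" and \<theta> :: "nat \<Rightarrow> real"
  assumes n: "1 \<le> n" and diag: "\<theta> n > 0" and nonpos: "\<And>j. 1 \<le> j \<Longrightarrow> j < n \<Longrightarrow> \<theta> j \<le> 0"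
    and sum: "(\<Sum>j=1..n. \<theta> j) \<ge> 0"
    and \<kappa>\<epsilon>: "\<kappa> > 0" "\<epsilon> > 0" and step: "\<kappa> * \<theta> n \<le> 4 * \<epsilon>\<^sup>2"
    and m: "\<And>j. 1 \<le> j \<Longrightarrow> j \<le> n \<Longrightarrow> square_integrable \<Omega> (m j)" and d: "square_integrable \<Omega> d"
  defines "w \<equiv> \<lambda>x. \<Sum>j=1..n. \<theta> j *\<^sub>R m j x"
  shows "\<kappa> / 2 * (\<Sum>j=1..n. \<theta> j * l2_inner \<Omega> (m j) (m j)) - \<kappa> * l2_inner \<Omega> w (m n)
    - \<kappa> / 2 * l2_inner \<Omega> w d - \<epsilon>\<^sup>2 / 2 * l2_inner \<Omega> d d \<le> 0"
proof -
  let ?I = "\<lambda>f. LINT x|lborel. indicator \<Omega> x * f x"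
  have w: "square_integrable \<Omega> w"
    unfolding w_def using m by (intro square_integrable_sum square_integrable_scaleR) auto
  have i: "integrable lborel (\<lambda>x. indicator \<Omega> x * (f x \<bullet> g x))"
    if "square_integrable \<Omega> f" "square_integrable \<Omega> g" for f g :: "real \<times> real \<Rightarrow> 'a"
    using square_integrable_inner[OF that] by (simp add: set_integrable_def)
  have mn: "square_integrable \<Omega> (m n)" using m n by simp
  define s where "s x = (\<Sum>j=1..n. \<theta> j * (indicator \<Omega> x * (m j x \<bullet> m j x)))" for x
  have si: "integrable lborel s" unfolding s_def using m
    by (intro Bochner_Integration.integrable_sum integrable_mult_right i) auto
  have s: "(LINT x|lborel. s x) = (\<Sum>j=1..n. \<theta> j * l2_inner \<Omega> (m j) (m j))"
    unfolding s_def using m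
    by (subst Bochner_Integration.integral_sum) (auto intro!: i simp: l2_inner_def set_lebesgue_integral_def)
  have "\<kappa> / 2 * (\<Sum>j=1..n. \<theta> j * l2_inner \<Omega> (m j) (m j)) - \<kappa> * l2_inner \<Omega> w (m n)
    - \<kappa> / 2 * l2_inner \<Omega> w d - \<epsilon>\<^sup>2 / 2 * l2_inner \<Omega> d d =
    (LINT x|lborel. \<kappa> / 2 * s x - \<kappa> * (indicator \<Omega> x * (w x \<bullet> m n x))
      - \<kappa> / 2 * (indicator \<Omega> x * (w x \<bullet> d x)) - \<epsilon>\<^sup>2 / 2 * (indicator \<Omega> x * (d x \<bullet> d x)))"
    using si i[OF w mn] i[OF w d] i[OF d d] unfolding s[symmetric] unfolding l2_inner_def set_lebesgue_integral_def real_scaleR_def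
    by (simp only: Bochner_Integration.integral_diff integral_mult_right_zero Bochner_Integration.integrable_diff integrable_mult_right)
  also have "\<dots> \<le> (LINT x|(lborel :: (real \<times> real) measure). (0 :: real))"
  proof (rule integral_mono)
    show "integrable lborel (\<lambda>x. \<kappa> / 2 * s x - \<kappa> * (indicator \<Omega> x * (w x \<bullet> m n x))
      - \<kappa> / 2 * (indicator \<Omega> x * (w x \<bullet> d x)) - \<epsilon>\<^sup>2 / 2 * (indicator \<Omega> x * (d x \<bullet> d x)))"
      using si i[OF w mn] i[OF w d] i[OF d d] by (intro Bochner_Integration.integrable_diff integrable_mult_right) auto
    fix x
    have "\<kappa> / 2 * (\<Sum>j=1..n. \<theta> j * (norm (m j x))\<^sup>2) - \<kappa> * (w x \<bullet> m n x) - \<kappa> / 2 * (w x \<bullet> d x) - \<epsilon>\<^sup>2 / 2 * (norm (d x))\<^sup>2 \<le> 0"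
      unfolding w_def by (rule energy_increment_density_nonpos[OF n diag nonpos sum \<kappa>\<epsilon> step])
    then show "\<kappa> / 2 * s x - \<kappa> * (indicator \<Omega> x * (w x \<bullet> m n x))
      - \<kappa> / 2 * (indicator \<Omega> x * (w x \<bullet> d x)) - \<epsilon>\<^sup>2 / 2 * (indicator \<Omega> x * (d x \<bullet> d x)) \<le> 0"
      by (cases "x \<in> \<Omega>") (simp_all add: s_def power2_norm_eq_inner)
  qed simp
  finally show ?thesis by simp
qed

theorem theorem3p2:
  fixes p q :: "real \<times> real"
    and \<alpha> \<kappa> \<epsilon> T :: real
    and N :: nat
    and t :: "nat \<Rightarrow> real"
    and \<phi> \<mu> :: "nat \<Rightarrow> real \<times> real \<Rightarrow> real"
  assumes "fst p < fst q" and "snd p < snd q"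
    and "0 < \<alpha>" and "\<alpha> < 1" and "\<kappa> > 0" and "\<epsilon> > 0"
    and "t 0 = 0" and "\<forall>n\<in>{1..N}. t (n - 1) < t n" and "t N = T"
    and "\<forall>n\<in>{1..N}. time_step t n \<le> (4 * \<epsilon>\<^sup>2 / (\<kappa> * Gamma (2 - \<alpha>))) powr (1 / \<alpha>)"
    and "L1_scheme_solution p q \<alpha> \<kappa> \<epsilon> N t \<phi> \<mu>"
  shows "\<forall>n\<in>{1..N}.
    (variational_energy p q \<alpha> \<kappa> \<epsilon> t \<phi> \<mu> n - variational_energy p q \<alpha> \<kappa> \<epsilon> t \<phi> \<mu> (n - 1)) / time_step t n \<le> 0"
proof
  fix n assume n: "n \<in> {1..N}"
  let ?\<Omega> = "box p q" and ?g = "weak_gradient p q"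
  note pq = assms(1,2) and \<alpha> = assms(3,4) and mesh = assms(8)
  define \<theta> where "\<theta> j = DOC_kernel \<alpha> t n (n - j)" for j
  define \<delta> where "\<delta> k x = \<phi> k x - \<phi> (k - 1) x" for k x
  define d where "d x = ?g (\<phi> n) x - ?g (\<phi> (n - 1)) x" for x
  define w where "w x = (\<Sum>j=1..n. \<theta> j *\<^sub>R ?g (\<mu> j) x)" for x
  have \<phi>: "\<phi> k \<in> H1_periodic p q" if "k \<le> n" for k
    using assms(11) n that by (auto simp: L1_scheme_solution_def)
  have \<mu>: "\<mu> k \<in> H1_periodic p q" if "1 \<le> k" "k \<le> n" for k
    using assms(11) n that by (auto simp: L1_scheme_solution_def)
  have eq1: "l2_inner ?\<Omega> (\<lambda>x. \<Sum>k=1..j. L1_kernel \<alpha> t j (j - k) * (\<phi> k x - \<phi> (k - 1) x)) v =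
      - \<kappa> * l2_inner ?\<Omega> (?g (\<mu> j)) (?g v)" if "1 \<le> j" "j \<le> n" "v \<in> H1_periodic p q" for j v
    using assms(11) n that by (auto simp: L1_scheme_solution_def)
  have eq2: "l2_inner ?\<Omega> (\<mu> n) v = l2_inner ?\<Omega> (\<lambda>x. (\<phi> n x) ^ 3 - \<phi> n x) v + \<epsilon>\<^sup>2 * l2_inner ?\<Omega> (?g (\<phi> n)) (?g v)"
    if "v \<in> H1_periodic p q" for v
    using assms(11) n that by (auto simp: L1_scheme_solution_def)
  note s\<phi> = H1_periodic_square_integrable[OF \<phi>] and s\<mu> = H1_periodic_square_integrable[OF \<mu>]
  have s\<delta>: "square_integrable ?\<Omega> (\<delta> n)"
    unfolding \<delta>_def using s\<phi> by (intro square_integrable_diff) auto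
  have sd: "square_integrable ?\<Omega> d"
    unfolding d_def using s\<phi> by (intro square_integrable_diff) auto
  have sw: "square_integrable ?\<Omega> w"
    unfolding w_def using s\<mu> by (intro square_integrable_sum square_integrable_scaleR) auto
  have orth: "(\<Sum>j=k..n. \<theta> j * L1_kernel \<alpha> t j (j - k)) = (if k = n then 1 else 0)" if "1 \<le> k" "k \<le> n" for k
    unfolding \<theta>_def using that n L1_kernel_pos[OF \<alpha> mesh, of k k] by (intro DOC_kernel_orthogonal) auto
  \<comment> \<open>The inverted scheme: the increment of \<open>\<phi>\<close> is \<open>\<kappa>\<close> times the weak divergence of \<open>w\<close>.\<close>
  have inverted: "l2_inner ?\<Omega> (\<delta> n) v = - \<kappa> * l2_inner ?\<Omega> w (?g v)" if v: "v \<in> H1_periodic p q" for v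
  proof -
    have "l2_inner ?\<Omega> (\<delta> n) v = (\<Sum>j=1..n. \<theta> j * (- \<kappa> * l2_inner ?\<Omega> (?g (\<mu> j)) (?g v)))"
    proof (rule orthogonal_kernel_inverts[where A = "\<lambda>j k. L1_kernel \<alpha> t j (j - k)"])
      fix j assume j: "1 \<le> j" "j \<le> n"
      show "(\<Sum>k=1..j. L1_kernel \<alpha> t j (j - k) * l2_inner ?\<Omega> (\<delta> k) v) = - \<kappa> * l2_inner ?\<Omega> (?g (\<mu> j)) (?g v)"
        unfolding eq1[OF j v, symmetric] \<delta>_def
        using j s\<phi>(1) H1_periodic_square_integrable(1)[OF v] by (intro l2_inner_increment_sum[symmetric]) auto
    qed (use orth n in auto)
    also have "\<dots> = - \<kappa> * l2_inner ?\<Omega> w (?g v)"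
      unfolding w_def using s\<mu>(2) H1_periodic_square_integrable(2)[OF v]
      by (subst l2_inner_sum_left) (auto simp: sum_distrib_left mult_ac sum_negf)
    finally show ?thesis .
  qed
  have \<delta>\<mu>: "l2_inner ?\<Omega> (\<delta> n) (\<mu> n) = - \<kappa> * l2_inner ?\<Omega> w (?g (\<mu> n))"
    using n by (intro inverted \<mu>) auto
  have \<delta>\<delta>: "l2_inner ?\<Omega> (\<delta> n) (\<delta> n) = - \<kappa> * l2_inner ?\<Omega> w d"
  proof -
    have "l2_inner ?\<Omega> (\<delta> n) (\<delta> n) = l2_inner ?\<Omega> (\<delta> n) (\<phi> n) - l2_inner ?\<Omega> (\<delta> n) (\<phi> (n - 1))"
      using l2_inner_diff_right[OF s\<delta> s\<phi>(1) s\<phi>(1), of n "n - 1"] by (simp add: \<delta>_def[abs_def])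
    also have "\<dots> = - \<kappa> * l2_inner ?\<Omega> w (?g (\<phi> n)) - - \<kappa> * l2_inner ?\<Omega> w (?g (\<phi> (n - 1)))"
      using inverted[OF \<phi>, of n] inverted[OF \<phi>, of "n - 1"] by simp
    also have "\<dots> = - \<kappa> * l2_inner ?\<Omega> w d"
      using l2_inner_diff_right[OF sw s\<phi>(2) s\<phi>(2), of n "n - 1"] by (simp add: d_def[abs_def] right_diff_distrib)
    finally show ?thesis .
  qed
  have \<mu>\<delta>: "l2_inner ?\<Omega> (\<delta> n) (\<mu> n) =
      (l2_inner ?\<Omega> (\<lambda>x. (\<phi> n x) ^ 3 - \<phi> n x) (\<phi> n) - l2_inner ?\<Omega> (\<lambda>x. (\<phi> n x) ^ 3 - \<phi> n x) (\<phi> (n - 1)))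
      + \<epsilon>\<^sup>2 * l2_inner ?\<Omega> (?g (\<phi> n)) d"
  proof -
    have "l2_inner ?\<Omega> (\<delta> n) (\<mu> n) = l2_inner ?\<Omega> (\<mu> n) (\<phi> n) - l2_inner ?\<Omega> (\<mu> n) (\<phi> (n - 1))"
      using l2_inner_diff_right[OF s\<mu>(1) s\<phi>(1) s\<phi>(1), of n n "n - 1"] n
      by (subst l2_inner_commute) (simp add: \<delta>_def[abs_def])
    moreover have "l2_inner ?\<Omega> (?g (\<phi> n)) d = l2_inner ?\<Omega> (?g (\<phi> n)) (?g (\<phi> n)) - l2_inner ?\<Omega> (?g (\<phi> n)) (?g (\<phi> (n - 1)))"
      using l2_inner_diff_right[OF s\<phi>(2) s\<phi>(2) s\<phi>(2), of n n "n - 1"] by (simp add: d_def[abs_def])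
    ultimately show ?thesis
      using eq2[OF \<phi>, of n] eq2[OF \<phi>, of "n - 1"] by (simp add: right_diff_distrib)
  qed
  have "energy p q \<epsilon> (\<phi> n) - energy p q \<epsilon> (\<phi> (n - 1)) \<le>
    - \<kappa> * l2_inner ?\<Omega> w (?g (\<mu> n)) - \<kappa> / 2 * l2_inner ?\<Omega> w d - \<epsilon>\<^sup>2 / 2 * l2_inner ?\<Omega> d d"
    using energy_diff_le[OF pq \<phi> \<phi>, of n "n - 1" \<epsilon>] \<delta>\<mu> \<delta>\<delta> \<mu>\<delta> unfolding \<delta>_def[abs_def] d_def[abs_def] by simp
  moreover have "\<kappa> / 2 * (\<Sum>j=1..n. \<theta> j * l2_inner ?\<Omega> (?g (\<mu> j)) (?g (\<mu> j))) - \<kappa> * l2_inner ?\<Omega> w (?g (\<mu> n))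
    - \<kappa> / 2 * l2_inner ?\<Omega> w d - \<epsilon>\<^sup>2 / 2 * l2_inner ?\<Omega> d d \<le> 0"
    unfolding w_def
  proof (rule integrated_energy_increment_nonpos)
    show "0 < \<theta> n" using DOC_kernel_diag_pos[OF \<alpha> mesh] n by (simp add: \<theta>_def)
    show "\<theta> j \<le> 0" if "1 \<le> j" "j < n" for j
      unfolding \<theta>_def using that n by (intro DOC_kernel_nonpos[OF \<alpha> mesh]) auto
    show "0 \<le> sum \<theta> {1..n}"
      unfolding \<theta>_def using n by (intro DOC_kernel_sum_nonneg[OF \<alpha> mesh]) auto
    show "\<kappa> * \<theta> n \<le> 4 * \<epsilon>\<^sup>2"
      using DOC_kernel_step_bound[OF \<alpha> assms(5,6) mesh n] assms(10) n by (simp add: \<theta>_def)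
  qed (use n assms s\<mu> sd in auto)
  moreover have "variational_energy p q \<alpha> \<kappa> \<epsilon> t \<phi> \<mu> n - variational_energy p q \<alpha> \<kappa> \<epsilon> t \<phi> \<mu> (n - 1) =
    energy p q \<epsilon> (\<phi> n) - energy p q \<epsilon> (\<phi> (n - 1)) + \<kappa> / 2 * (\<Sum>j=1..n. \<theta> j * l2_inner ?\<Omega> (?g (\<mu> j)) (?g (\<mu> j)))"
    using DCC_kernel_sum_diff[of n \<alpha> t "\<lambda>j. l2_inner ?\<Omega> (?g (\<mu> j)) (?g (\<mu> j))"] n
    unfolding variational_energy_def l2_norm_power2 \<theta>_def
    by (simp add: algebra_simps flip: right_diff_distrib)
  ultimately have "variational_energy p q \<alpha> \<kappa> \<epsilon> t \<phi> \<mu> n - variational_energy p q \<alpha> \<kappa> \<epsilon> t \<phi> \<mu> (n - 1) \<le> 0"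
    by linarith
  moreover have "0 < time_step t n" using mesh n by (simp add: time_step_def)
  ultimately show "(variational_energy p q \<alpha> \<kappa> \<epsilon> t \<phi> \<mu> n - variational_energy p q \<alpha> \<kappa> \<epsilon> t \<phi> \<mu> (n - 1)) / time_step t n \<le> 0"
    by (rule divide_nonpos_pos)
qed

end
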